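(* Let $1\le k<n$, $X=Gr(k,n)$, $\eta\in\mathcal{P}_{k,n}$ and $1\le i\le n-k$. For $1\le d<\min\{k+1,n-k\}$, $$\Gamma_d(X^i,X_\eta)=\Big\{V_k\in X\ \Big|\ \begin{array}{l}\dim V_k\cap F^{\rm opp}_{j+\eta_{k-j+1}}\ge j-d\ \text{ for } d+1\le j\le k,\\ \dim V_k\cap\big(F^{\rm opp}_{s+\eta_{k-s+1}}+F_{n-k+1-i}\big)\ge s-d+1\ \text{ for } d\le s\le k\end{array}\Big\}.$$ In particular, $\Gamma_d(X^{n-k},X_\eta)$ is a Schubert variety given by $$\Gamma_d(X^{n-k},X_\eta)=X_{\tilde\eta}(\tilde F_\bullet)=g\cdot X_{\tilde\eta},$$ where $\tilde\eta_j=\min\{\eta_{j-d+1}+d,\ n-k\}$ for $1\le j\le k$, with the convention $\eta_i:=n$ for $i\le0$.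
   Context: $X=Gr(k,n)$ is the Grassmannian of $k$-dimensional subspaces of $\mathbb{C}^n$, $\mathcal{P}_{k,n}=\{(\lambda_1,\dots,\lambda_k)\in\mathbb{Z}^k\mid n-k\ge\lambda_1\ge\cdots\ge\lambda_k\ge 0\}$. Let $e_1,\dots,e_n$ be the standard basis, $F_j=\langle e_1,\dots,e_j\rangle$ and $F^{\rm opp}_j=\langle e_n,e_{n-1},\dots,e_{n-j+1}\rangle$. Schubert varieties: $X^\lambda=\{V\in X\mid\dim V\cap F_{n-k+j-\lambda_j}\ge j,\ 1\le j\le k\}$; $X^i:=X^{(i,0,\dots,0)}=\{V\mid \dim V\cap F_{n-k+1-i}\ge1\}$; for a complete flag $G_\bullet$, $X_\lambda(G_\bullet)=\{V\in X\mid\dim V\cap G_{j+\lambda_{k+1-j}}\ge j,\ 1\le j\le k\}$, and $X_\lambda:=X_\lambda(F^{\rm opp}_\bullet)$. $\tilde F_\bullet$ is the complete flag with $\tilde F_1=\mathbb{C}e_1$ and $\tilde F_j=\langle e_1,e_n,e_{n-1},\dots,e_{n-j+2}\rangle$ for $2\le j\le n$; $g$ is the cyclic permutation matrix with $g e_n=e_1$, $g e_j=e_{j+1}$ for $1\le j<n$, so that $\tilde F_\bullet=g\cdot F^{\rm opp}_\bullet$. For closed subvarieties $Y,Z\subset X$, $\Gamma_d(Y,Z):=\mathrm{ev}_3\big(\mathrm{ev}_1^{-1}(Y)\cap\mathrm{ev}_2^{-1}(Z)\big)\subset X$, where $\mathrm{ev}_i:\overline{\mathcal{M}}_{0,3}(X,d)\to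 X$ are the evaluation maps on the moduli space of genus zero three-pointed stable maps of degree $d$ (class $d$ times the class of a line). *)

theory Defs
  imports "HOL-Analysis.Analysis"
begin

text \<open>
  The ambient space is \<open>complex ^ 'n\<close> with \<open>n = CARD('n)\<close>; the linear order on \<open>'n\<close> enumerates
  the standard basis. Linear algebra over the complex numbers is taken from the library
  interpretation \<open>vec\<close> (the unqualified \<open>subspace\<close>, \<open>dim\<close>, \<open>span\<close> are the real notions).
  Sequences such as partitions and flags are functions on \<open>nat\<close> with 1-based indices; values
  outside the relevant range are irrelevant.
\<close>

section \<open>Grassmannians, flags and Schubert varieties\<close>

definition Gr :: "nat \<Rightarrow> (complex ^ 'n) set set" where
  "Gr k = {V. vec.subspace V \<and> vec.dim V = k}"

definition partitions_in :: "nat \<Rightarrow> nat \<Rightarrow> (nat \<Rightarrow> nat) set" where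
  "partitions_in k n =
     {lam. (\<forall>j\<in>{1..k}. lam j \<le> n - k) \<and> (\<forall>j\<in>{1..<k}. lam (j + 1) \<le> lam j)}"

definition idx :: "nat \<Rightarrow> 'n::{finite,linorder}" where
  "idx j = sorted_list_of_set (UNIV :: 'n set) ! (j - 1)"

definition e_vec :: "nat \<Rightarrow> complex ^ ('n::{finite,linorder})" where
  "e_vec j = axis (idx j) 1"

definition complete_flag :: "(nat \<Rightarrow> (complex ^ 'n) set) \<Rightarrow> bool" where
  "complete_flag G \<longleftrightarrow>
     (\<forall>j\<le>CARD('n). vec.subspace (G j) \<and> vec.dim (G j) = j) \<and>
     (\<forall>j<CARD('n). G j \<subseteq> G (j + 1))"

definition F_std :: "nat \<Rightarrow> (complex ^ ('n::{finite,linorder})) set" where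
  "F_std j = vec.span (e_vec ` {1..j})"

definition F_opp :: "nat \<Rightarrow> (complex ^ ('n::{finite,linorder})) set" where
  "F_opp j = vec.span (e_vec ` {CARD('n) - j + 1..CARD('n)})"

definition F_tilde :: "nat \<Rightarrow> (complex ^ ('n::{finite,linorder})) set" where
  "F_tilde j =
     (if j = 0 then {0} else vec.span (insert (e_vec 1) (e_vec ` {CARD('n) + 2 - j..CARD('n)})))"

definition X_up :: "nat \<Rightarrow> (nat \<Rightarrow> nat) \<Rightarrow> (complex ^ ('n::{finite,linorder})) set set" where
  "X_up k lam = {V \<in> Gr k. \<forall>j\<in>{1..k}. vec.dim (V \<inter> F_std (CARD('n) - k + j - lam j)) \<ge> j}"

definition X_special :: "nat \<Rightarrow> nat \<Rightarrow> (complex ^ ('n::{finite,linorder})) set set" where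
  "X_special k i = X_up k (\<lambda>j. if j = 1 then i else 0)"

definition X_flag ::
    "nat \<Rightarrow> (nat \<Rightarrow> nat) \<Rightarrow> (nat \<Rightarrow> (complex ^ 'n) set) \<Rightarrow> (complex ^ 'n) set set" where
  "X_flag k lam G = {V \<in> Gr k. \<forall>j\<in>{1..k}. vec.dim (V \<inter> G (j + lam (k + 1 - j))) \<ge> j}"

definition X_low :: "nat \<Rightarrow> (nat \<Rightarrow> nat) \<Rightarrow> (complex ^ ('n::{finite,linorder})) set set" where
  "X_low k lam = X_flag k lam F_opp"

definition cyc :: "complex ^ ('n::{finite,linorder}) ^ ('n::{finite,linorder})" where
  "cyc = (\<chi> a b. if (\<exists>j\<in>{1..<CARD('n)}. a = idx (j + 1) \<and> b = idx j)
                   \<or> (a = idx 1 \<and> b = idx CARD('n)) then 1 else 0)"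

definition translate :: "complex ^ 'n ^ 'n \<Rightarrow> (complex ^ 'n) set set \<Rightarrow> (complex ^ 'n) set set" where
  "translate A S = (\<lambda>V. (*v) A ` V) ` S"

definition eta_ext :: "nat \<Rightarrow> (nat \<Rightarrow> nat) \<Rightarrow> int \<Rightarrow> nat" where
  "eta_ext n eta m = (if m \<le> 0 then n else eta (nat m))"

definition eta_tilde :: "nat \<Rightarrow> nat \<Rightarrow> nat \<Rightarrow> (nat \<Rightarrow> nat) \<Rightarrow> nat \<Rightarrow> nat" where
  "eta_tilde n k d eta j = min (eta_ext n eta (int j - int d + 1) + d) (n - k)"


section \<open>Morphisms from the projective line to the Grassmannian\<close>

text \<open>The projective line is \<open>Gr 1\<close> in \<open>complex ^ 2\<close>.\<close>

abbreviation P1 :: "(complex ^ 2) set set" where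
  "P1 \<equiv> Gr 1"

text \<open>
  The minor, with column indices \<open>xs\<close>, of the matrix with rows \<open>vs\<close>. (Leibniz formula: the library
  determinant on \<open>_ ^ _ ^ _\<close> is not available because the size \<open>k\<close> is a number, not a type.)
\<close>

definition minor :: "(complex ^ 'n) list \<Rightarrow> 'n list \<Rightarrow> complex" where
  "minor vs xs =
     (\<Sum>p | p permutes {..<length vs}.
        of_int (sign p) * (\<Prod>a<length vs. (vs ! a) $ (xs ! p a)))"

definition plucker_coords ::
    "nat \<Rightarrow> (complex ^ ('n::{finite,linorder})) set \<Rightarrow> ('n::{finite,linorder} list \<Rightarrow> complex) \<Rightarrow> bool" where
  "plucker_coords k V P \<longleftrightarrow>
     (\<exists>vs. length vs = k \<and> distinct vs \<and> vec.independent (set vs) \<and> vec.span (set vs) = V \<and>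
        (\<forall>xs. length xs = k \<and> sorted_wrt (<) xs \<longrightarrow> P xs = minor vs xs))"

definition binary_form :: "nat \<Rightarrow> (nat \<Rightarrow> complex) \<Rightarrow> complex ^ 2 \<Rightarrow> complex" where
  "binary_form d c x = (\<Sum>m\<le>d. c m * (x $ 1) ^ m * (x $ 2) ^ (d - m))"

text \<open>
  \<open>f\<close> is a morphism from the projective line to the Grassmannian with
  \<open>f\<^sub>*[P1] = d [line]\<close>. Since the class of a line is detected by the Pluecker line bundle \<open>O(1)\<close>, this
  means that in the Pluecker embedding \<open>f\<close> is given by binary forms of degree \<open>d\<close> without common zero.
  Pluecker coordinates of a point are determined up to a nonzero factor, which for \<open>k \<ge> 1\<close> is
  accounted for by the choice of a basis in \<open>plucker_coords\<close>; they never vanish simultaneously, so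
  that the forms indeed have no common zero.
\<close>

definition morphism_of_degree ::
    "nat \<Rightarrow> nat \<Rightarrow> ((complex ^ 2) set \<Rightarrow> (complex ^ ('n::{finite,linorder})) set) \<Rightarrow> bool" where
  "morphism_of_degree k d f \<longleftrightarrow>
     (\<exists>c. \<forall>x. x \<noteq> 0 \<longrightarrow>
        f (vec.span {x}) \<in> Gr k \<and>
        plucker_coords k (f (vec.span {x})) (\<lambda>xs. binary_form d (c xs) x))"


section \<open>Three-pointed stable maps of genus zero\<close>

text \<open>
  A connected nodal curve of arithmetic genus zero is given by its normalization, a finite disjoint
  union of projective lines, together with the pairs of points that are glued to nodes; a point of
  the normalization is a pair of (the label of) a component and a point of \<open>P1\<close>. A morphism from
  such a curve is a family of morphisms on the components taking equal values on the two
  preimages of each node. The marked points are \<open>mark 1\<close>, \<open>mark 2\<close>, \<open>mark 3\<close>.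
\<close>

record 'n pointed_map =
  comps :: "nat set"
  nodes :: "(nat \<times> (complex ^ 2) set) set set"
  mark :: "nat \<Rightarrow> nat \<times> (complex ^ 2) set"
  cmap :: "nat \<Rightarrow> (complex ^ 2) set \<Rightarrow> (complex ^ 'n) set"

definition point_val :: "'n::finite pointed_map \<Rightarrow> nat \<times> (complex ^ 2) set \<Rightarrow> (complex ^ 'n) set" where
  "point_val M p = cmap M (fst p) (snd p)"

definition ev :: "nat \<Rightarrow> 'n::finite pointed_map \<Rightarrow> (complex ^ 'n) set" where
  "ev i M = point_val M (mark M i)"

definition adjacent :: "'n::finite pointed_map \<Rightarrow> (nat \<times> nat) set" where
  "adjacent M = {(a, b). \<exists>x y. {(a, x), (b, y)} \<in> nodes M}"

text \<open>
  The arithmetic genus of a connected nodal curve with rational components is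
  (number of nodes) - (number of components) + 1.
\<close>

definition prestable_curve :: "'n::finite pointed_map \<Rightarrow> bool" where
  "prestable_curve M \<longleftrightarrow>
     finite (comps M) \<and> comps M \<noteq> {} \<and>
     finite (nodes M) \<and> (\<forall>N\<in>nodes M. N \<subseteq> comps M \<times> P1 \<and> card N = 2) \<and>
     pairwise disjnt (nodes M) \<and>
     (\<forall>a\<in>comps M. \<forall>b\<in>comps M. (a, b) \<in> (adjacent M)\<^sup>*) \<and>
     card (nodes M) + 1 = card (comps M) \<and>
     mark M ` {1..3} \<subseteq> comps M \<times> P1 - \<Union>(nodes M) \<and> inj_on (mark M) {1..3}"

definition special_points :: "'n::finite pointed_map \<Rightarrow> nat \<Rightarrow> (complex ^ 2) set set" where
  "special_points M a = {x. (a, x) \<in> \<Union>(nodes M) \<union> mark M ` {1..3}}"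

definition map_of_degree :: "nat \<Rightarrow> nat \<Rightarrow> 'n::{finite,linorder} pointed_map \<Rightarrow> bool" where
  "map_of_degree k d M \<longleftrightarrow>
     (\<exists>deg. (\<forall>a\<in>comps M. morphism_of_degree k (deg a) (cmap M a)) \<and> (\<Sum>a\<in>comps M. deg a) = d) \<and>
     (\<forall>N\<in>nodes M. \<forall>p\<in>N. \<forall>q\<in>N. point_val M p = point_val M q)"

text \<open>
  Representatives of the points of the moduli space of stable maps of degree \<open>d\<close> to \<open>Gr k\<close>; the
  evaluation maps \<open>ev i\<close> are constant on isomorphism classes.
\<close>

definition stable_maps :: "nat \<Rightarrow> nat \<Rightarrow> 'n::{finite,linorder} pointed_map set" where
  "stable_maps k d =
     {M. prestable_curve M \<and> map_of_degree k d M \<and>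
         (\<forall>a\<in>comps M. cmap M a constant_on P1 \<longrightarrow> card (special_points M a) \<ge> 3)}"

definition Gamma_curves ::
    "nat \<Rightarrow> nat \<Rightarrow> (complex ^ ('n::{finite,linorder})) set set \<Rightarrow> (complex ^ ('n::{finite,linorder})) set set
      \<Rightarrow> (complex ^ ('n::{finite,linorder})) set set" where
  "Gamma_curves k d Y Z = ev 3 ` {M \<in> stable_maps k d. ev 1 M \<in> Y \<and> ev 2 M \<in> Z}"

end

theory Submission imports Defs begin

text \<open>
  The proof replaces stable maps by linear algebra in the ambient space. A point \<open>V\<close> lies in
  \<open>\<Gamma>\<^sub>d(X\<^sup>i, X\<^sub>\<eta>)\<close> iff there are a point \<open>V'\<close> of \<open>X\<^sub>\<eta>\<close> and a nonzero vector \<open>v\<close> of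
  \<open>F = F\<^bsub>n-k+1-i\<^esub>\<close> such that \<open>V + V' + \<langle>v\<rangle>\<close> has dimension at most \<open>k + d\<close>
  (\<open>Gamma_curves_incident\<close>).

  One direction holds because all the subspaces parametrized by a stable map of degree \<open>d\<close> lie in
  one space of dimension \<open>k + d\<close>. For a single projective line (\<open>rational_curve_span\<close>) this is a
  count of zeros. If the subspaces \<open>f x\<close> span more than \<open>k + d\<close> dimensions, then one can pick
  \<open>d + 1\<close> points \<open>x\<^sub>t\<close> and vectors \<open>w\<^sub>t \<in> f x\<^sub>t\<close> that are independent modulo some fixed \<open>f y\<close>.
  The condition that \<open>f x\<close> meets a complement of \<open>f y\<close> containing all \<open>w\<^sub>t\<close> is the vanishing of a
  binary form of degree \<open>d\<close>, by the Cauchy-Binet formula; that form vanishes at all \<open>x\<^sub>t\<close> but not at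
  \<open>y\<close>, which is impossible. On a reducible curve the spans of adjacent components share the
  \<open>k\<close>-dimensional value at the node, so that degrees add up (\<open>stable_map_span\<close>).

  For the other direction one writes down a morphism from the projective line whose value at each
  point is spanned by \<open>k\<close> explicit vectors, of the form \<open>s a + t b\<close> except for one of higher degree
  (\<open>curve_through\<close>), and attaches a contracted component if marked points have to coincide
  (\<open>Gamma_curvesI\<close>).

  It remains to compare with the dimension conditions, where \<open>P\<^sub>j = F\<^sup>o\<^sup>p\<^sup>p\<^bsub>j + \<eta>(k-j+1)\<^esub>\<close>. That the
  incidence implies \<open>dim (V \<inter> P\<^sub>j) \<ge> j - d\<close> and \<open>dim (V \<inter> (P\<^sub>j + F)) \<ge> j - d + 1\<close> is a dimension
  count; the second bound uses that \<open>P\<^sub>j\<close> and \<open>F\<close> either intersect trivially or span everything.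
  Conversely, for \<open>d \<ge> 2\<close> a subspace satisfying these conditions can be changed by adding one vector
  and then passing to a hyperplane so that it satisfies the conditions for \<open>d - 1\<close>
  (\<open>near_condition_step\<close>), and for \<open>d = 1\<close> the same operation leads to \<open>V'\<close> and \<open>v\<close>
  (\<open>near_condition_base\<close>).

  For \<open>i = n - k\<close> the space \<open>F\<close> is the line through \<open>e\<^sub>1\<close>, and \<open>P\<^sub>j + F\<close> is the member of the
  shifted flag whose index is one larger. The bounds on \<open>V \<inter> (P\<^sub>j + F)\<close> then imply those on
  \<open>V \<inter> P\<^sub>j\<close> and are the conditions for the Schubert variety of \<open>\<eta>\<close> shifted by \<open>d - 1\<close>.
\<close>

section \<open>Subspaces of coordinate space\<close>

lemma set_plus_eq_span:
  fixes S T :: "(complex ^ 'n) set"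
  assumes "vec.subspace S" "vec.subspace T"
  shows "S + T = vec.span (S \<union> T)"
  using assms by (auto simp: vec.span_Un vec.span_eq_iff[THEN iffD2] set_plus_def)

lemma subspace_set_plus:
  fixes S T :: "(complex ^ 'n) set"
  assumes "vec.subspace S" "vec.subspace T"
  shows "vec.subspace (S + T)"
  using assms by (simp add: set_plus_eq_span)

lemma subspace_plus_least:
  fixes S T :: "(complex ^ 'n) set"
  assumes "vec.subspace B" "S \<subseteq> B" "T \<subseteq> B"
  shows "S + T \<subseteq> B"
  using assms vec.subspace_add by (fastforce simp: set_plus_def)

lemma subspace_le_plus:
  fixes S T :: "(complex ^ 'n) set"
  assumes "vec.subspace S" "vec.subspace T"
  shows "S \<subseteq> S + T" "T \<subseteq> S + T"
  using assms by (simp_all add: set_plus_eq_span vec.span_superset le_supE)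
    (meson le_supE vec.span_superset)+

lemma dim_plus_Int:
  fixes S T :: "(complex ^ 'n) set"
  assumes "vec.subspace S" "vec.subspace T"
  shows "vec.dim (S + T) + vec.dim (S \<inter> T) = vec.dim S + vec.dim T"
proof -
  have "S + T = {x + y |x y. x \<in> S \<and> y \<in> T}"
    by (auto simp: set_plus_def)
  then show ?thesis using vec.dim_sums_Int[OF assms] by simp
qed

lemma dim_Int_lower:
  fixes S T B :: "(complex ^ 'n) set"
  assumes "vec.subspace S" "vec.subspace T" "vec.subspace B" "S \<subseteq> B" "T \<subseteq> B"
  shows "vec.dim S + vec.dim T \<le> vec.dim (S \<inter> T) + vec.dim B"
  using dim_plus_Int[OF assms(1,2)] vec.dim_subset[OF subspace_plus_least[OF assms(3-5)]]
  by linarith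

lemma dim_plus_common:
  fixes S T A :: "(complex ^ 'n) set"
  assumes "vec.subspace S" "vec.subspace T" "A \<subseteq> S" "A \<subseteq> T"
  shows "vec.dim (S + T) + vec.dim A \<le> vec.dim S + vec.dim T"
  using dim_plus_Int[OF assms(1,2)] vec.dim_subset[of A "S \<inter> T"] assms(3,4) by auto

lemma dim_plus_line:
  fixes V :: "(complex ^ 'n) set"
  assumes "vec.subspace V"
  shows "vec.dim (V + vec.span {u}) = (if u \<in> V then vec.dim V else vec.dim V + 1)"
proof -
  have "V + vec.span {u} = vec.span (V \<union> vec.span {u})"
    using assms by (simp add: set_plus_eq_span)
  also have "\<dots> = vec.span (insert u V)"
    by (auto simp: vec.span_eq intro: vec.span_base subsetD[OF vec.span_mono[of "{u}"]])
  finally show ?thesis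
    using assms vec.dim_insert[of u V] by (simp add: vec.span_eq_iff[THEN iffD2])
qed

lemma basis_extending:
  fixes T :: "(complex ^ 'n) set"
  assumes "vec.independent B" "B \<subseteq> T" "vec.subspace T"
  obtains C where "B \<subseteq> C" "C \<subseteq> T" "vec.independent C" "vec.span C = T" "card C = vec.dim T" "finite C"
proof -
  obtain C where C: "B \<subseteq> C" "C \<subseteq> T" "vec.independent C" "T \<subseteq> vec.span C"
    using vec.maximal_independent_subset_extend[OF assms(2,1)] by blast
  have sp: "vec.span C = T" using C assms(3) by (simp add: subset_antisym vec.span_minimal)
  moreover have "finite C \<and> card C = vec.dim T"
    using vec.indep_card_eq_dim_span[OF C(3)] sp by simp
  ultimately show thesis using that C by blast
qed

lemma subspace_between:
  fixes D T :: "(complex ^ 'n) set"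
  assumes "vec.subspace D" "vec.subspace T" "D \<subseteq> T" "vec.dim D \<le> m" "m \<le> vec.dim T"
  obtains H where "vec.subspace H" "D \<subseteq> H" "H \<subseteq> T" "vec.dim H = m"
proof -
  obtain B where B: "B \<subseteq> D" "vec.independent B" "vec.span B = D" "card B = vec.dim D" "finite B"
    using basis_extending[of "{}" D] assms(1) vec.independent_empty by auto
  obtain C where C: "B \<subseteq> C" "C \<subseteq> T" "vec.independent C" "vec.span C = T" "card C = vec.dim T" "finite C"
    using basis_extending[OF B(2) _ assms(2)] B(1) assms(3) by blast
  have "m - card B \<le> card (C - B)"
    using C(1,5) assms(5) B(4,5) by (simp add: card_Diff_subset)
  then obtain E where E: "E \<subseteq> C - B" "card E = m - card B" "finite E"
    by (rule obtain_subset_with_card_n)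
  have sub: "B \<union> E \<subseteq> C" using E(1) C(1) by blast
  have "vec.dim (vec.span (B \<union> E)) = card (B \<union> E)"
    using vec.dim_span_eq_card_independent vec.independent_mono[OF C(3) sub] by blast
  also have "\<dots> = m"
    using card_Un_disjoint[of B E] E B(4,5) assms(4) by auto
  finally have "vec.dim (vec.span (B \<union> E)) = m" .
  moreover have "D \<subseteq> vec.span (B \<union> E)" using B(3) vec.span_mono[of B "B \<union> E"] by blast
  moreover have "vec.span (B \<union> E) \<subseteq> T" using vec.span_mono[OF sub] C(4) by blast
  ultimately show thesis using that vec.subspace_span by blast
qed

text \<open>
The complement is found by extending a basis of \<open>A \<oplus> W\<close> to one of \<open>T\<close> and dropping the vectors of
\<open>A\<close>. It is applied both with \<open>T\<close> the whole space and with \<open>T\<close> a hyperplane.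
\<close>

lemma complement_containing:
  fixes A W T :: "(complex ^ 'n) set"
  assumes "vec.subspace A" "vec.subspace W" "vec.subspace T" "A \<subseteq> T" "W \<subseteq> T" "A \<inter> W \<subseteq> {0}"
  obtains C where "vec.subspace C" "W \<subseteq> C" "C \<subseteq> T" "A \<inter> C \<subseteq> {0}" "vec.dim A + vec.dim C = vec.dim T"
proof -
  obtain BA where BA: "BA \<subseteq> A" "vec.independent BA" "vec.span BA = A" "card BA = vec.dim A" "finite BA"
    using basis_extending[of "{}" A] assms(1) vec.independent_empty by auto
  obtain BW where BW: "BW \<subseteq> W" "vec.independent BW" "vec.span BW = W" "card BW = vec.dim W" "finite BW"
    using basis_extending[of "{}" W] assms(2) vec.independent_empty by auto
  have dis: "BA \<inter> BW = {}"
    using assms(6) BA(1,2) BW(1) vec.dependent_zero by blast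
  have ind: "vec.independent (BA \<union> BW)"
  proof (rule vec.card_le_dim_spanning[where V = "A + W"])
    show "A + W \<subseteq> vec.span (BA \<union> BW)"
      by (simp add: vec.span_Un BA BW set_plus_def) blast
    show "BA \<union> BW \<subseteq> A + W" using subspace_le_plus[OF assms(1,2)] BA BW by blast
    have "vec.dim (A \<inter> W) = 0" using assms(6) by (simp add: vec.dim_eq_0)
    then have "vec.dim (A + W) = vec.dim A + vec.dim W"
      using dim_plus_Int[OF assms(1,2)] by linarith
    then show "card (BA \<union> BW) \<le> vec.dim (A + W)"
      using BA BW dis by (simp add: card_Un_disjoint)
  qed (use BA BW in simp)
  obtain E where E: "BA \<union> BW \<subseteq> E" "E \<subseteq> T" "vec.independent E" "vec.span E = T" "card E = vec.dim T" "finite E"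
    using basis_extending[OF ind _ assms(3)] BA(1) BW(1) assms(4,5) by blast
  let ?C = "vec.span (E - BA)"
  have dimC: "vec.dim A + vec.dim ?C = vec.dim T"
    using vec.dim_span_eq_card_independent[OF vec.independent_mono[OF E(3), of "E - BA"]]
      E BA card_mono[of E BA] by (simp add: card_Diff_subset)
  have "A + ?C = T"
    using E(1,4) BA(3) vec.span_Un[of BA "E - BA"] by (auto simp: set_plus_def Un_absorb1)
  then have "vec.dim (A \<inter> ?C) = 0"
    using dim_plus_Int[OF assms(1) vec.subspace_span, of "E - BA"] dimC by simp
  then have "A \<inter> ?C \<subseteq> {0}" by (simp add: vec.dim_eq_0)
  moreover have "W \<subseteq> ?C" using BW(3) vec.span_mono[of BW "E - BA"] E(1) dis by blast
  moreover have "?C \<subseteq> T" using vec.span_mono[of "E - BA" E] E(4) by blast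
  ultimately show thesis using that[OF vec.subspace_span] dimC by blast
qed

lemma subspace_eqI:
  fixes S T :: "(complex ^ 'n) set"
  assumes "vec.subspace S" "vec.subspace T" "S \<subseteq> T" "vec.dim S = vec.dim T"
  shows "S = T"
  using vec.subspace_dim_equal[OF assms(1-3)] assms(4) by simp

lemma hyperplane_avoiding:
  fixes U V :: "(complex ^ 'n) set"
  assumes "vec.subspace U" "\<not> V \<subseteq> U"
  obtains H where "vec.subspace H" "U \<subseteq> H" "\<not> V \<subseteq> H" "vec.dim H + 1 = CARD('n)"
proof -
  obtain v where v: "v \<in> V" "v \<notin> U" using assms(2) by blast
  have v0: "v \<noteq> 0" using v(2) assms(1) vec.subspace_0 by blast
  have "vec.span {v} \<inter> U \<subseteq> {0}"
  proof
    fix x assume "x \<in> vec.span {v} \<inter> U"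
    then obtain c where c: "x = c *s v" "x \<in> U" by (auto simp: vec.span_singleton)
    have "c = 0"
      using c v(2) vec.subspace_scale[OF assms(1), of x "inverse c"]
      by (cases "c = 0") (auto simp del: vec.scale_scale simp add: vector_smult_assoc)
    then show "x \<in> {0}" using c by simp
  qed
  then obtain H where H: "vec.subspace H" "U \<subseteq> H" "vec.span {v} \<inter> H \<subseteq> {0}"
      "vec.dim (vec.span {v}) + vec.dim H = vec.dim (UNIV :: (complex ^ 'n) set)"
    using complement_containing[of "vec.span {v}" U UNIV] assms(1) by auto
  have "v \<notin> H" using H(3) v0 vec.span_base[of v "{v}"] by blast
  then have "\<not> V \<subseteq> H" using v by blast
  moreover have "vec.dim H + 1 = CARD('n)"
    using H(4) v0 by (simp add: vec.dim_span vec_dim_card del: vec.dim_UNIV)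
  ultimately show thesis using that H by blast
qed

section \<open>Determinants of arbitrary size\<close>

text \<open>
The entries are a function on pairs of numbers since the size is a number and not a type.
\<close>

definition ldet :: "nat \<Rightarrow> (nat \<Rightarrow> nat \<Rightarrow> complex) \<Rightarrow> complex" where
  "ldet k m = (\<Sum>p | p permutes {..<k}. of_int (sign p) * (\<Prod>a<k. m a (p a)))"

lemma minor_eq_ldet: "minor vs xs = ldet (length vs) (\<lambda>a b. vs ! a $ (xs ! b))"
  by (simp add: minor_def ldet_def)

lemma ldet_cong:
  assumes "\<And>a b. a < k \<Longrightarrow> b < k \<Longrightarrow> m a b = m' a b"
  shows "ldet k m = ldet k m'"
  unfolding ldet_def
  by (intro sum.cong prod.cong arg_cong2[where f = "(*)"] refl)
     (use assms permutes_in_image in \<open>force\<close>)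

lemma ldet_transpose: "ldet k (\<lambda>a b. m b a) = ldet k m"
proof -
  have "ldet k (\<lambda>a b. m b a)
      = (\<Sum>p | p permutes {..<k}. of_int (sign (inv p)) * (\<Prod>a<k. m (inv p a) a))"
    unfolding ldet_def by (rule sum_permutations_inverse)
  also have "\<dots> = ldet k m"
    unfolding ldet_def
  proof (intro sum.cong refl arg_cong2[where f = "(*)"])
    fix p assume "p \<in> {p. p permutes {..<k}}"
    then have p: "p permutes {..<k}" by simp
    show "complex_of_int (sign (inv p)) = of_int (sign p)"
      using p by (metis finite_lessThan permutation_permutes sign_inverse)
    have "(\<Prod>a<k. m (inv p a) a) = (\<Prod>a<k. m (inv p (p a)) (p a))"
      using prod.permute[OF p, of "\<lambda>a. m (inv p a) a"] by simp
    then show "(\<Prod>a<k. m (inv p a) a) = (\<Prod>a<k. m a (p a))"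
      using permutes_inverses(2)[OF p] by simp
  qed
  finally show ?thesis .
qed

lemma ldet_permute_columns:
  assumes q: "q permutes {..<k}"
  shows "ldet k (\<lambda>a b. m a (q b)) = of_int (sign q) * ldet k m"
proof -
  have perm: "permutation p" if "p permutes {..<k}" for p
    using that permutation_permutes finite_lessThan by blast
  have "of_int (sign q) * ldet k m
      = (\<Sum>p | p permutes {..<k}. of_int (sign q) * (of_int (sign (q \<circ> p)) * (\<Prod>a<k. m a (q (p a)))))"
    unfolding ldet_def sum_distrib_left
    by (subst setum_permutations_compose_left[OF q]) simp
  also have "\<dots> = ldet k (\<lambda>a b. m a (q b))"
    unfolding ldet_def
  proof (intro sum.cong refl)
    fix p assume "p \<in> {p. p permutes {..<k}}"
    then have "sign (q \<circ> p) = sign q * sign p" using perm q by (simp add: sign_compose)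
    moreover have "sign q * sign q = 1" by (simp add: sign_def)
    ultimately have "sign q * sign (q \<circ> p) = sign p" by (simp add: mult.assoc[symmetric])
    then show "of_int (sign q) * (of_int (sign (q \<circ> p)) * (\<Prod>a<k. m a (q (p a))))
        = (of_int (sign p) * (\<Prod>a<k. m a (q (p a))) :: complex)"
      by (metis mult.assoc of_int_mult)
  qed
  finally show ?thesis by simp
qed

lemma ldet_equal_columns:
  assumes "b < k" "b' < k" "b \<noteq> b'" "\<And>a. a < k \<Longrightarrow> m a b = m a b'"
  shows "ldet k m = 0"
proof -
  let ?q = "Transposition.transpose b b'"
  have q: "?q permutes {..<k}" using assms by (simp add: permutes_swap_id)
  have "ldet k m = ldet k (\<lambda>a c. m a (?q c))"
    by (rule ldet_cong) (use assms(4) in \<open>auto simp: Transposition.transpose_def\<close>)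
  also have "\<dots> = - ldet k m"
    using ldet_permute_columns[OF q, of m] assms(3) by (simp add: sign_swap_id)
  finally show ?thesis by simp
qed

text \<open>
Replacing row \<open>r\<close> by the vanishing combination of all rows gives \<open>0\<close>; by linearity in that row, and
since matrices with two equal rows contribute nothing, it also gives \<open>c r\<close> times the determinant.
\<close>

lemma ldet_dependent_rows:
  assumes dep: "\<And>b. b < k \<Longrightarrow> (\<Sum>a<k. c a * m a b) = 0" and r: "r < k" "c r \<noteq> 0"
  shows "ldet k m = 0"
proof -
  have zero: "ldet k (\<lambda>a b. if a = r then m a' b else m a b) = 0" if "a' < k" "a' \<noteq> r" for a'
    by (subst ldet_transpose[symmetric], rule ldet_equal_columns[of r _ a']) (use that r in auto)
  have lin: "ldet k (\<lambda>a b. if a = r then x b else m a b)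
      = (\<Sum>p | p permutes {..<k}. (of_int (sign p) * (\<Prod>a\<in>{..<k}-{r}. m a (p a))) * x (p r))" for x
    unfolding ldet_def using r(1) by (intro sum.cong refl) (simp add: prod.remove[of _ r])
  have "0 = ldet k (\<lambda>a b. if a = r then (\<Sum>a'<k. c a' * m a' b) else m a b)"
    unfolding lin using dep r(1) permutes_in_image[of _ "{..<k}" r]
    by (intro sum.neutral[symmetric]) auto
  also have "\<dots> = (\<Sum>a'<k. c a' * ldet k (\<lambda>a b. if a = r then m a' b else m a b))"
    unfolding lin sum_distrib_left by (subst sum.swap) (simp add: mult_ac)
  also have "\<dots> = (\<Sum>a'<k. if a' = r then c r * ldet k m else 0)"
    using zero by (intro sum.cong refl) (auto intro!: ldet_cong)
  also have "\<dots> = c r * ldet k m" using r(1) by simp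
  finally show ?thesis using r(2) by simp
qed

lemma ldet_identity:
  assumes "\<And>a b. a < k \<Longrightarrow> b < k \<Longrightarrow> m a b = (if a = b then 1 else 0)"
  shows "ldet k m = 1"
proof -
  have "ldet k m = (\<Sum>p | p permutes {..<k}. if p = id then 1 else 0)"
    unfolding ldet_def
  proof (intro sum.cong refl)
    fix p assume "p \<in> {p. p permutes {..<k}}"
    then have p: "p permutes {..<k}" by simp
    show "of_int (sign p) * (\<Prod>a<k. m a (p a)) = (if p = id then 1 else 0)"
    proof (cases "p = id")
      case False
      then obtain a where a: "p a \<noteq> a" by (auto simp: fun_eq_iff)
      then have "a < k" using p by (auto simp: permutes_def)
      moreover have "p a < k" using \<open>a < k\<close> permutes_in_image[OF p, of a] by simp
      ultimately have "(\<Prod>a<k. m a (p a)) = 0" using assms a by (auto intro!: bexI[of _ a])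
      then show ?thesis using False by simp
    qed (simp add: assms sign_id)
  qed
  also have "\<dots> = 1" by (simp add: finite_permutations permutes_id)
  finally show ?thesis .
qed

text \<open>
The sum runs over all maps \<open>g\<close> to the column indices rather than over \<open>k\<close>-element sets of columns.
Each set is then counted \<open>k!\<close> times, which accounts for the factor, and no choice of an ordering of
the columns enters the proof: expanding the left side gives the sum of \<open>\<Prod>a. v a (g a)\<close> times the
minor of \<open>\<phi>\<close>, and averaging over all permutations of the arguments of \<open>g\<close> turns the product into
the minor of \<open>v\<close>.
\<close>

lemma Cauchy_Binet:
  fixes v \<phi> :: "nat \<Rightarrow> 'n::finite \<Rightarrow> complex"
  shows "fact k * ldet k (\<lambda>a b. \<Sum>c\<in>UNIV. v a c * \<phi> b c)
    = (\<Sum>g\<in>{..<k} \<rightarrow>\<^sub>E UNIV. ldet k (\<lambda>a b. v a (g b)) * ldet k (\<lambda>a b. \<phi> a (g b)))"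
proof -
  let ?G = "{..<k} \<rightarrow>\<^sub>E (UNIV :: 'n set)" and ?P = "{p. p permutes {..<k}}"
  let ?h = "\<lambda>g. \<Prod>a<k. v a (g a)" and ?E = "\<lambda>g. ldet k (\<lambda>a b. \<phi> a (g b))"
  let ?D = "ldet k (\<lambda>a b. \<Sum>c\<in>UNIV. v a c * \<phi> b c)"
  have "?D = (\<Sum>p\<in>?P. of_int (sign p) * (\<Sum>g\<in>?G. \<Prod>a<k. v a (g a) * \<phi> (p a) (g a)))"
    unfolding ldet_def by (subst prod_sum_PiE) auto
  also have "\<dots> = (\<Sum>g\<in>?G. ?h g * ldet k (\<lambda>a b. \<phi> b (g a)))"
    unfolding ldet_def sum_distrib_left
    by (subst sum.swap) (simp add: prod.distrib mult_ac)
  also have "\<dots> = (\<Sum>g\<in>?G. ?h g * ?E g)"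
    using ldet_transpose[of k "\<lambda>a b. \<phi> a (_ b)"] by (intro sum.cong refl) (metis ldet_transpose)
  finally have D: "?D = (\<Sum>g\<in>?G. ?h g * ?E g)" .
  have twist: "?D = (\<Sum>g\<in>?G. of_int (sign q) * ?h (g \<circ> q) * ?E g)" if q: "q permutes {..<k}" for q
  proof -
    have into: "g \<circ> p \<in> ?G" if "p permutes {..<k}" "g \<in> ?G" for g p
      using that unfolding PiE_def extensional_def permutes_def by auto
    have "bij_betw (\<lambda>g. g \<circ> q) ?G ?G"
      by (rule bij_betwI[where g = "\<lambda>g. g \<circ> inv q"])
         (auto simp: into[OF q] into[OF permutes_inv[OF q]] comp_assoc permutes_inv_o[OF q]
           simp del: PiE_iff intro!: into[OF q] into[OF permutes_inv[OF q]])
    then have "?D = (\<Sum>g\<in>?G. ?h (g \<circ> q) * ?E (g \<circ> q))"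
      unfolding D by (rule sum.reindex_bij_betw[symmetric])
    then show ?thesis using ldet_permute_columns[OF q, of "\<lambda>a b. \<phi> a (_ b)"]
      by (simp add: o_def ldet_permute_columns[OF q, where m = "\<lambda>a b. \<phi> a (_ b)"] mult_ac)
  qed
  have "fact k * ?D = (\<Sum>q\<in>?P. ?D)"
    by (simp add: card_permutations)
  also have "\<dots> = (\<Sum>q\<in>?P. \<Sum>g\<in>?G. of_int (sign q) * ?h (g \<circ> q) * ?E g)"
    by (intro sum.cong refl twist) simp
  also have "\<dots> = (\<Sum>g\<in>?G. ldet k (\<lambda>a b. v a (g b)) * ?E g)"
    by (subst sum.swap) (simp add: ldet_def[of k "\<lambda>a b. v a (_ b)"] sum_distrib_right)
  finally show ?thesis .
qed

section \<open>The span of a rational curve in a Grassmannian\<close>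

text \<open>
Pluecker coordinates are only given for increasing lists of columns. This reduces any choice of
columns to such a list, the scalar \<open>\<epsilon>\<close> being the sign of the sorting permutation.
\<close>

lemma ldet_any_columns:
  fixes g :: "nat \<Rightarrow> 'n::linorder"
  obtains \<epsilon> xs where "length xs = k" "sorted_wrt (<) xs"
      "\<And>v. ldet k (\<lambda>a b. v a (g b)) = \<epsilon> * ldet k (\<lambda>a b. v a (xs ! b))"
  | "\<And>v. ldet k (\<lambda>a b. v a (g b)) = 0"
proof (cases "inj_on g {..<k}")
  case False
  then obtain b b' where b: "b < k" "b' < k" "b \<noteq> b'" "g b = g b'" by (auto simp: inj_on_def)
  then have "ldet k (\<lambda>a b. v a (g b)) = 0" for v
    using ldet_equal_columns[OF b(1-3)] by simp
  then show thesis by (rule that(2))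
next
  case True
  define ys where "ys = map g [0..<k]"
  have dist: "distinct ys" using True by (simp add: ys_def distinct_map atLeast0LessThan)
  obtain q where q: "q permutes {..<length (sort ys)}" "permute_list q (sort ys) = ys"
    using mset_eq_permutation[of ys "sort ys"] by (metis mset_sort)
  have len: "length (sort ys) = k" by (simp add: ys_def)
  have g: "g b = sort ys ! q b" if "b < k" for b
    using permute_list_nth[OF q(1), of b] that len by (simp add: q(2)) (simp add: ys_def)
  have "ldet k (\<lambda>a b. v a (g b)) = of_int (sign q) * ldet k (\<lambda>a b. v a (sort ys ! b))" for v
    using ldet_permute_columns[of q k "\<lambda>a b. v a (sort ys ! b)"] q(1) len
    by (simp add: g cong: ldet_cong)
  moreover have "sorted_wrt (<) (sort ys)"
    using dist by (simp add: strict_sorted_iff)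
  ultimately show thesis using that(1) len by blast
qed

lemma binary_form_sum:
  "(\<Sum>g\<in>A. h g * binary_form d (c g) x) = binary_form d (\<lambda>m. \<Sum>g\<in>A. h g * c g m) x"
  unfolding binary_form_def sum_distrib_left sum_distrib_right
  by (subst sum.swap) (simp add: mult_ac)

text \<open>
By the Cauchy-Binet formula, evaluating \<open>k\<close> linear functionals on a basis of \<open>f x\<close> gives a
determinant that is a linear combination of the Pluecker coordinates of \<open>f x\<close>. The bases \<open>B\<close> are
chosen once for all functionals, so that functionals dual to the basis at one particular point can
be used.
\<close>

lemma functional_determinant_form:
  fixes f :: "(complex ^ 2) set \<Rightarrow> (complex ^ 'n::{finite,linorder}) set"
  assumes "morphism_of_degree k d f"
  obtains B where
    "\<And>x. x \<noteq> 0 \<Longrightarrow> length (B x) = k \<and> distinct (B x) \<and> vec.independent (set (B x)) \<and>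
      vec.span (set (B x)) = f (vec.span {x})"
    "\<And>\<phi> :: nat \<Rightarrow> 'n::{finite,linorder} \<Rightarrow> complex. \<exists>e. \<forall>x. x \<noteq> 0 \<longrightarrow>
      binary_form d e x = fact k * ldet k (\<lambda>a b. \<Sum>j\<in>UNIV. B x ! a $ j * \<phi> b j)"
proof -
  from assms obtain c where "\<And>x. x \<noteq> 0 \<Longrightarrow>
      plucker_coords k (f (vec.span {x})) (\<lambda>xs. binary_form d (c xs) x)"
    unfolding morphism_of_degree_def by blast
  then have "\<forall>x. \<exists>vs. x \<noteq> 0 \<longrightarrow> length vs = k \<and> distinct vs \<and> vec.independent (set vs) \<and>
      vec.span (set vs) = f (vec.span {x}) \<and>
      (\<forall>xs. length xs = k \<and> sorted_wrt (<) xs \<longrightarrow> binary_form d (c xs) x = minor vs xs)"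
    unfolding plucker_coords_def by blast
  from choice[OF this] obtain B where B: "\<And>x. x \<noteq> 0 \<Longrightarrow> length (B x) = k \<and> distinct (B x) \<and>
      vec.independent (set (B x)) \<and> vec.span (set (B x)) = f (vec.span {x}) \<and>
      (\<forall>xs. length xs = k \<and> sorted_wrt (<) xs \<longrightarrow> binary_form d (c xs) x = minor (B x) xs)"
    by blast
  let ?ok = "\<lambda>x vs. \<forall>xs. length xs = k \<and> sorted_wrt (<) xs \<longrightarrow>
     binary_form d (c xs) x = ldet k (\<lambda>a b. vs ! a $ (xs ! b))"
  have "\<exists>e. \<forall>x vs. ?ok x vs \<longrightarrow> ldet k (\<lambda>a b. vs ! a $ g b) = binary_form d e x" for g
  proof (cases rule: ldet_any_columns[where k = k and g = g])
    case (1 \<epsilon> xs)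
    have "ldet k (\<lambda>a b. vs ! a $ g b) = binary_form d (\<lambda>m. \<epsilon> * c xs m) x" if "?ok x vs" for x vs
    proof -
      have "ldet k (\<lambda>a b. vs ! a $ (xs ! b)) = binary_form d (c xs) x" using that 1(1,2) by simp
      then show ?thesis unfolding 1(3)[of "\<lambda>a. ($) (vs ! a)"]
        by (simp add: binary_form_def sum_distrib_left mult.assoc)
    qed
    then show ?thesis by blast
  next
    case 2
    then show ?thesis
      by (intro exI[of _ "\<lambda>_. 0"]) (simp add: binary_form_def 2[of "\<lambda>a. ($) (_ ! a)"])
  qed
  then obtain E where E: "\<And>g x vs. ?ok x vs \<Longrightarrow> ldet k (\<lambda>a b. vs ! a $ g b) = binary_form d (E g) x"
    by metis
  have "\<exists>e. \<forall>x. x \<noteq> 0 \<longrightarrow>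
      binary_form d e x = fact k * ldet k (\<lambda>a b. \<Sum>j\<in>UNIV. B x ! a $ j * \<phi> b j)"
    for \<phi> :: "nat \<Rightarrow> 'n::{finite,linorder} \<Rightarrow> complex"
  proof (intro exI allI impI)
    let ?e = "\<lambda>m. \<Sum>g\<in>{..<k} \<rightarrow>\<^sub>E UNIV. ldet k (\<lambda>a b. \<phi> a (g b)) * E g m"
    fix x :: "complex ^ 2" assume "x \<noteq> 0"
    from B[OF this] have ok: "?ok x (B x)" by (simp add: minor_eq_ldet)
    have "fact k * ldet k (\<lambda>a b. \<Sum>j\<in>UNIV. B x ! a $ j * \<phi> b j)
      = (\<Sum>g\<in>{..<k} \<rightarrow>\<^sub>E UNIV. ldet k (\<lambda>a b. \<phi> a (g b)) * binary_form d (E g) x)"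
      unfolding Cauchy_Binet by (simp add: E[OF ok] mult.commute)
    also have "\<dots> = binary_form d ?e x"
      unfolding binary_form_sum ..
    finally show "binary_form d ?e x = fact k * ldet k (\<lambda>a b. \<Sum>j\<in>UNIV. B x ! a $ j * \<phi> b j)" ..
  qed
  with that B show thesis by blast
qed

lemma span_list_combination:
  fixes vs :: "(complex ^ 'n) list"
  assumes "distinct vs" "v \<in> vec.span (set vs)"
  obtains c where "v = (\<Sum>a<length vs. c a *s vs ! a)"
proof -
  obtain u where u: "v = (\<Sum>w\<in>set vs. u w *s w)"
    using assms(2) by (auto simp: vec.span_finite)
  have "bij_betw ((!) vs) {..<length vs} (set vs)"
    using assms(1) by (simp add: bij_betw_nth)
  then have "v = (\<Sum>a<length vs. u (vs ! a) *s vs ! a)"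
    unfolding u by (rule sum.reindex_bij_betw[symmetric])
  then show thesis by (rule that)
qed

text \<open>
The form is the determinant of \<open>k\<close> functionals that vanish on a complement of \<open>f y\<close> containing \<open>W\<close>
and are dual to a basis of \<open>f y\<close>. If \<open>f x\<close> contains a nonzero vector of \<open>W\<close>, that vector expresses a
linear dependence between the rows of the matrix.
\<close>

lemma intersection_form:
  fixes f :: "(complex ^ 2) set \<Rightarrow> (complex ^ 'n::{finite,linorder}) set"
  assumes f: "morphism_of_degree k d f" and y: "y \<noteq> 0"
    and W: "vec.subspace W" "f (vec.span {y}) \<inter> W \<subseteq> {0}"
  obtains e where "binary_form d e y \<noteq> 0"
    "\<And>x. x \<noteq> 0 \<Longrightarrow> \<not> f (vec.span {x}) \<inter> W \<subseteq> {0} \<Longrightarrow> binary_form d e x = 0"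
proof -
  obtain B where B: "\<And>x. x \<noteq> 0 \<Longrightarrow> length (B x) = k \<and> distinct (B x) \<and> vec.independent (set (B x)) \<and>
      vec.span (set (B x)) = f (vec.span {x})"
    "\<And>\<phi> :: nat \<Rightarrow> 'n \<Rightarrow> complex. \<exists>e. \<forall>x. x \<noteq> 0 \<longrightarrow>
      binary_form d e x = fact k * ldet k (\<lambda>a b. \<Sum>j\<in>UNIV. B x ! a $ j * \<phi> b j)"
    by (rule functional_determinant_form[OF f]) (rule that)
  define vy where "vy = B y"
  have vy: "length vy = k" "distinct vy" "vec.independent (set vy)"
      "vec.span (set vy) = f (vec.span {y})"
    using B(1)[OF y] by (simp_all add: vy_def)
  have k: "k \<le> CARD('n)"
    using vec.independent_card_le_dim[OF subset_UNIV vy(3)] vy(1,2)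
    by (simp add: distinct_card vec_dim_card del: vec.dim_UNIV)
  then obtain \<iota> :: "nat \<Rightarrow> 'n" where \<iota>: "inj_on \<iota> {..<k}"
    using card_le_inj[of "{..<k}" "UNIV :: 'n set"] by auto
  obtain C where C: "vec.subspace C" "W \<subseteq> C" "f (vec.span {y}) \<inter> C \<subseteq> {0}"
      "vec.dim (f (vec.span {y})) + vec.dim C = vec.dim (UNIV :: ((complex, 'n) vec) set)"
    by (rule complement_containing[OF _ W(1) vec.subspace_UNIV subset_UNIV subset_UNIV W(2)])
       (use vy(4) vec.subspace_span[of "set vy"] in auto)
  obtain BC where BC: "BC \<subseteq> C" "vec.independent BC" "vec.span BC = C" "finite BC"
    using basis_extending[of "{}" C] C(1) vec.independent_empty by auto
  have dis: "set vy \<inter> BC = {}"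
    using C(3) BC(1) vec.span_superset[of "set vy"] vy(3,4) vec.dependent_zero by blast
  have ind: "vec.independent (set vy \<union> BC)"
  proof (rule vec.card_le_dim_spanning[where V = UNIV])
    have 0: "vec.dim (f (vec.span {y}) \<inter> C) = 0" using C(3) by (simp add: vec.dim_eq_0)
    have "vec.dim (f (vec.span {y}) + C) = vec.dim (UNIV :: ((complex, 'n) vec) set)"
      using dim_plus_Int[OF vec.subspace_span[of "set vy"] C(1), unfolded vy(4)] C(4) 0 by linarith
    moreover have "f (vec.span {y}) + C = vec.span (set vy \<union> BC)"
      using vy(4) BC(3) by (auto simp: vec.span_Un set_plus_def)
    ultimately show "UNIV \<subseteq> vec.span (set vy \<union> BC)"
      using vec.dim_eq_full[of "set vy \<union> BC"] by (simp add: vec.dimension_def)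
    show "card (set vy \<union> BC) \<le> vec.dim (UNIV :: ((complex, 'n) vec) set)"
      using C(4) card_Un_disjoint[OF _ BC(4) dis] vec.dim_span_eq_card_independent[OF vy(3)]
        vec.dim_span_eq_card_independent[OF BC(2)] vy(4) BC(3) by simp
  qed (use BC in auto)
  \<comment> \<open>The functionals are the coordinates \<open>\<iota> b\<close> of a single linear map \<open>G\<close> killing \<open>C\<close>.\<close>
  define h where "h = (\<lambda>w. if w \<in> set vy then axis (\<iota> (the_inv_into {..<k} ((!) vy) w)) 1 else (0 :: (complex, 'n) vec))"
  obtain G where G: "Vector_Spaces.linear (*s) (*s) G" "\<forall>w\<in>set vy \<union> BC. G w = h w"
    using vec.linear_independent_extend[OF ind] by blast
  define \<phi> where "\<phi> = (\<lambda>b j. matrix G $ \<iota> b $ j)"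
  have \<phi>: "(\<Sum>j\<in>UNIV. v $ j * \<phi> b j) = G v $ \<iota> b" for v b
    using matrix_works[OF G(1), of v] by (auto simp: \<phi>_def matrix_vector_mult_def vec_eq_iff mult.commute)
  have Gvy: "G (vy ! a) $ \<iota> b = (if a = b then 1 else 0)" if "a < k" "b < k" for a b
  proof -
    have "inj_on ((!) vy) {..<k}" using vy(1,2) by (simp add: inj_on_nth)
    then have "the_inv_into {..<k} ((!) vy) (vy ! a) = a" using that by (simp add: the_inv_into_f_f)
    then have "G (vy ! a) = axis (\<iota> a) 1" using G(2) that vy(1) by (simp add: h_def)
    then show ?thesis using \<iota> that by (auto simp: axis_def inj_on_def)
  qed
  have GW: "G w = 0" if "w \<in> W" for w
  proof -
    have "w \<in> vec.span BC" using that C(2) BC(3) by blast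
    then show ?thesis
    proof (rule vec.linear_eq_0_on_span[OF G(1), rotated])
      fix x assume "x \<in> BC"
      then show "G x = 0" using G(2) dis by (auto simp: h_def)
    qed
  qed
  obtain e where e: "\<And>x. x \<noteq> 0 \<Longrightarrow>
      binary_form d e x = fact k * ldet k (\<lambda>a b. \<Sum>j\<in>UNIV. B x ! a $ j * \<phi> b j)"
    using B(2)[of \<phi>] by blast
  show thesis
  proof (rule that[of e])
    fix x :: "complex ^ 2" assume x: "x \<noteq> 0" "\<not> f (vec.span {x}) \<inter> W \<subseteq> {0}"
    then obtain w where w: "w \<in> f (vec.span {x})" "w \<in> W" "w \<noteq> 0" by blast
    define vs where "vs = B x"
    have vs: "length vs = k" "distinct vs" "vec.span (set vs) = f (vec.span {x})"
      "binary_form d e x = fact k * ldet k (\<lambda>a b. \<Sum>j\<in>UNIV. vs ! a $ j * \<phi> b j)"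
      using e[OF x(1)] B(1)[OF x(1)] by (simp_all add: vs_def)
    obtain c where c: "w = (\<Sum>a<k. c a *s vs ! a)"
      using span_list_combination[OF vs(2)] w(1) vs(1,3) by metis
    have "\<not> (\<forall>a<k. c a = 0)"
    proof
      assume "\<forall>a<k. c a = 0"
      then have "w = 0" unfolding c by (intro sum.neutral) simp
      then show False using w(3) by simp
    qed
    then obtain r where r: "r < k" "c r \<noteq> 0" by blast
    have "(\<Sum>a<k. c a * G (vs ! a) $ \<iota> b) = 0" for b
    proof -
      have "0 = G w $ \<iota> b" using GW[OF w(2)] by simp
      also have "G w = (\<Sum>a<k. c a *s G (vs ! a))"
        unfolding c vec.linear_sum[OF G(1)] by (simp add: vec.linear_scale[OF G(1)])
      finally show ?thesis by (simp add: sum_component)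
    qed
    then show "binary_form d e x = 0"
      unfolding vs(4) \<phi> using ldet_dependent_rows[where r = r and c = c] r by auto
  next
    have "binary_form d e y = fact k * ldet k (\<lambda>a b. G (vy ! a) $ \<iota> b)"
      using e[OF y] by (simp add: vy_def \<phi>)
    also have "ldet k (\<lambda>a b. G (vy ! a) $ \<iota> b) = 1" by (rule ldet_identity) (rule Gvy)
    finally show "binary_form d e y \<noteq> 0" by simp
  qed
qed

abbreviation affine_pt :: "complex \<Rightarrow> complex ^ 2" where
  "affine_pt t \<equiv> vector [t, 1]"

lemma affine_pt_nonzero: "affine_pt t \<noteq> 0"
  by (simp add: vec_eq_iff exI[of _ 2])

lemma form_zeros:
  assumes "binary_form d e y \<noteq> 0"
  shows "finite {t. binary_form d e (affine_pt t) = 0}"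
    and "card {t. binary_form d e (affine_pt t) = 0} \<le> d"
proof -
  have "\<exists>m\<le>d. e m \<noteq> 0"
    using assms by (metis (no_types, lifting) atMost_iff binary_form_def mult_eq_0_iff sum.neutral)
  from polyfun_rootbound[OF this]
  show "finite {t. binary_form d e (affine_pt t) = 0}"
      "card {t. binary_form d e (affine_pt t) = 0} \<le> d"
    by (simp_all add: binary_form_def)
qed

lemma morphism_GrD:
  assumes "morphism_of_degree k d f" "x \<noteq> 0"
  shows "vec.subspace (f (vec.span {x}))" "vec.dim (f (vec.span {x})) = k"
  using assms by (auto simp: morphism_of_degree_def Gr_def)

text \<open>
Choose a hyperplane \<open>H\<close> containing \<open>U\<close> but not \<open>f x\<close>, and in \<open>H\<close> a complement \<open>W\<close> of \<open>f x \<inter> H\<close>, which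
has dimension \<open>n - k\<close>. Every \<open>k\<close>-dimensional subspace of \<open>H\<close> meets \<open>W\<close>, but \<open>f x\<close> does not, so the
form of \<open>W\<close> is nonzero and vanishes wherever \<open>f\<close> takes a value inside \<open>U\<close>.
\<close>

lemma curve_leaves_subspace:
  fixes f :: "(complex ^ 2) set \<Rightarrow> (complex ^ 'n::{finite,linorder}) set"
  assumes f: "morphism_of_degree k d f" and U: "vec.subspace U"
    and x: "x \<noteq> 0" "\<not> f (vec.span {x}) \<subseteq> U"
  shows "finite {t. f (vec.span {affine_pt t}) \<subseteq> U}"
proof -
  obtain H where H: "vec.subspace H" "U \<subseteq> H" "\<not> f (vec.span {x}) \<subseteq> H" "vec.dim H + 1 = CARD('n)"
    by (rule hyperplane_avoiding[OF U x(2)])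
  let ?V = "f (vec.span {x})"
  note V = morphism_GrD[OF f x(1)]
  obtain W where W: "vec.subspace W" "W \<subseteq> H" "(?V \<inter> H) \<inter> W \<subseteq> {0}"
      "vec.dim (?V \<inter> H) + vec.dim W = vec.dim H"
    by (rule complement_containing[of "?V \<inter> H" "{0}" H])
       (use H(1) V(1) vec.subspace_inter vec.subspace_0 in auto)
  have "H \<subset> ?V + H" using subspace_le_plus[OF V(1) H(1)] H(3) by blast
  then have "vec.dim H < vec.dim (?V + H)"
    using vec.dim_psubset[of H "?V + H"] H(1) subspace_set_plus[OF V(1) H(1)]
    by (simp add: vec.span_eq_iff[THEN iffD2])
  then have dimW: "CARD('n) \<le> k + vec.dim W"
    using dim_plus_Int[OF V(1) H(1)] V(2) W(4) H(4) by linarith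
  have "?V \<inter> W \<subseteq> {0}" using W(2,3) by blast
  then obtain e where e: "binary_form d e x \<noteq> 0"
    "\<And>x. x \<noteq> 0 \<Longrightarrow> \<not> f (vec.span {x}) \<inter> W \<subseteq> {0} \<Longrightarrow> binary_form d e x = 0"
    using intersection_form[OF f x(1) W(1)] by blast
  have "binary_form d e (affine_pt t) = 0" if t: "f (vec.span {affine_pt t}) \<subseteq> U" for t
  proof (rule e(2)[OF affine_pt_nonzero])
    let ?V' = "f (vec.span {affine_pt t})"
    note V' = morphism_GrD[OF f affine_pt_nonzero[of t]]
    have "k + vec.dim W \<le> vec.dim (?V' \<inter> W) + vec.dim H"
      using dim_Int_lower[OF V'(1) W(1) H(1)] t H(2) W(2) V'(2) by auto
    then have "vec.dim (?V' \<inter> W) \<noteq> 0" using dimW H(4) by linarith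
    then show "\<not> ?V' \<inter> W \<subseteq> {0}" by (simp add: vec.dim_eq_0)
  qed
  then have "{t. f (vec.span {affine_pt t}) \<subseteq> U} \<subseteq> {t. binary_form d e (affine_pt t) = 0}" by auto
  then show ?thesis by (rule finite_subset) (rule form_zeros(1)[OF e(1)])
qed

text \<open>
The points \<open>t\<close> and the space \<open>W\<close> spanned by the vectors \<open>w\<^sub>t\<close> are built one at a time; as long as
\<open>f y + W\<close> is not the whole span, all but finitely many points give a new vector. Only points of the
affine line are used, which makes the count of zeros one for polynomials in one variable.
\<close>

lemma rational_curve_span:
  fixes f :: "(complex ^ 2) set \<Rightarrow> (complex ^ 'n::{finite,linorder}) set"
  assumes f: "morphism_of_degree k d f"
  shows "\<exists>B. vec.subspace B \<and> vec.dim B \<le> k + d \<and> (\<forall>x. x \<noteq> 0 \<longrightarrow> f (vec.span {x}) \<subseteq> B)"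
proof (rule ccontr)
  define B where "B = vec.span (\<Union>x\<in>{x. x \<noteq> 0}. f (vec.span {x}))"
  have Bsub: "vec.subspace B" by (simp add: B_def)
  have B: "f (vec.span {x}) \<subseteq> B" if "x \<noteq> 0" for x
    unfolding B_def using that by (intro order.trans[OF _ vec.span_superset]) auto
  assume "\<nexists>B. vec.subspace B \<and> vec.dim B \<le> k + d \<and> (\<forall>x. x \<noteq> 0 \<longrightarrow> f (vec.span {x}) \<subseteq> B)"
  then have big: "k + d < vec.dim B" using B Bsub by (meson not_le)
  define y where "y = affine_pt 0"
  have y: "y \<noteq> 0" by (simp add: y_def affine_pt_nonzero)
  note V = morphism_GrD[OF f y]
  let ?good = "\<lambda>j T W. finite T \<and> card T = j \<and> vec.subspace W \<and> vec.dim W = j \<and>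
    f (vec.span {y}) \<inter> W \<subseteq> {0} \<and> (\<forall>t\<in>T. \<not> f (vec.span {affine_pt t}) \<inter> W \<subseteq> {0})"
  have "\<exists>T W. ?good j T W" if "j \<le> d + 1" for j
    using that
  proof (induction j)
    case 0
    show ?case by (intro exI[of _ "{}"] exI[of _ "{0}"]) (auto simp: vec.subspace_0)
  next
    case (Suc j)
    then obtain T W where W: "?good j T W" by auto
    let ?U = "f (vec.span {y}) + W"
    have U: "vec.subspace ?U" using V(1) W subspace_set_plus by blast
    have "vec.dim ?U \<le> k + j" using dim_plus_Int[of "f (vec.span {y})" W] V W by auto
    then have "\<not> B \<subseteq> ?U" using vec.dim_subset[of B ?U] big Suc.prems by linarith
    then have "\<not> (\<Union>x\<in>{x. x \<noteq> 0}. f (vec.span {x})) \<subseteq> ?U"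
      unfolding B_def using vec.span_minimal[OF _ U] by metis
    then obtain x where x: "x \<noteq> 0" "\<not> f (vec.span {x}) \<subseteq> ?U" by fast
    have "infinite (UNIV - (T \<union> {t. f (vec.span {affine_pt t}) \<subseteq> ?U}))"
      using curve_leaves_subspace[OF f U x] W by (intro Diff_infinite_finite) (auto simp: infinite_UNIV_char_0)
    then have "UNIV - (T \<union> {t. f (vec.span {affine_pt t}) \<subseteq> ?U}) \<noteq> {}"
      by (rule infinite_imp_nonempty)
    then obtain t where t: "t \<notin> T" "\<not> f (vec.span {affine_pt t}) \<subseteq> ?U" by fast
    then obtain w where w: "w \<in> f (vec.span {affine_pt t})" "w \<notin> ?U" by blast
    let ?W = "W + vec.span {w}"
    have WU: "W \<subseteq> ?U" using subspace_le_plus(2) V(1) W by blast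
    have sub: "vec.subspace ?W" using W by (auto intro: subspace_set_plus)
    have "vec.dim ?W = Suc j" using dim_plus_line[of W w] W w(2) WU by auto
    moreover have "f (vec.span {y}) \<inter> ?W \<subseteq> {0}"
    proof
      fix z assume z: "z \<in> f (vec.span {y}) \<inter> ?W"
      then obtain a c where ac: "z = a + c *s w" "a \<in> W"
        by (auto simp: set_plus_def vec.span_singleton)
      have "c = 0"
      proof (rule ccontr)
        assume "c \<noteq> 0"
        have "z - a \<in> ?U"
          using z ac(2) subspace_le_plus[of "f (vec.span {y})" W] V(1) W U vec.subspace_diff by blast
        then have "inverse c *s (z - a) \<in> ?U" by (rule vec.subspace_scale[OF U])
        then show False using w(2) ac(1) \<open>c \<noteq> 0\<close> by (simp add: vector_smult_assoc del: vec.scale_scale)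
      qed
      then show "z \<in> {0}" using z ac W by auto
    qed
    moreover have "\<forall>s\<in>insert t T. \<not> f (vec.span {affine_pt s}) \<inter> ?W \<subseteq> {0}"
    proof
      have le: "W \<subseteq> ?W" "w \<in> ?W" using subspace_le_plus[of W "vec.span {w}"] W vec.span_base by auto
      have "w \<noteq> 0" using w(2) vec.subspace_0[OF U] by blast
      fix s assume "s \<in> insert t T"
      then show "\<not> f (vec.span {affine_pt s}) \<inter> ?W \<subseteq> {0}"
        using le w(1) \<open>w \<noteq> 0\<close> W by blast
    qed
    ultimately have "?good (Suc j) (insert t T) ?W" using W t(1) sub by simp
    then show ?case by blast
  qed
  then obtain T W where W: "?good (d + 1) T W" by blast
  then obtain e where e: "binary_form d e y \<noteq> 0"
    "\<And>x. x \<noteq> 0 \<Longrightarrow> \<not> f (vec.span {x}) \<inter> W \<subseteq> {0} \<Longrightarrow> binary_form d e x = 0"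
    using intersection_form[OF f y] by blast
  have "T \<subseteq> {t. binary_form d e (affine_pt t) = 0}"
    using e(2) affine_pt_nonzero W by blast
  then have "card T \<le> d" using card_mono form_zeros[OF e(1)] by (meson le_trans)
  then show False using W by simp
qed

section \<open>The span of a stable map\<close>

lemma P1_iff: "p \<in> Gr (Suc 0) \<longleftrightarrow> (\<exists>x. x \<noteq> 0 \<and> p = vec.span {x})"
proof
  assume "p \<in> Gr (Suc 0)"
  then have p: "vec.subspace p" "vec.dim p = 1" by (auto simp: Gr_def)
  then obtain B where B: "B \<subseteq> p" "vec.independent B" "vec.span B = p" "card B = vec.dim p" "finite B"
    using basis_extending[of "{}" p] vec.independent_empty by auto
  then obtain x where "B = {x}" using p(2) card_1_singletonE by metis
  then show "\<exists>x. x \<noteq> 0 \<and> p = vec.span {x}"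
    using B(2,3) vec.dependent_single[of x] by (intro exI[of _ x]) auto
next
  assume "\<exists>x. x \<noteq> 0 \<and> p = vec.span {x}"
  then show "p \<in> Gr (Suc 0)" by (auto simp: Gr_def vec.dim_span)
qed

lemma rtrancl_leaves:
  assumes "(a, b) \<in> R\<^sup>*" "a \<in> C" "b \<notin> C"
  shows "\<exists>u v. (u, v) \<in> R \<and> u \<in> C \<and> v \<notin> C"
  using assms by (induction rule: rtrancl_induct) auto

text \<open>
A set of components is grown one component at a time along nodes. The new span and the old one share
the \<open>k\<close>-dimensional value at the node, so the dimension increases by at most the degree of the new
component.
\<close>

lemma stable_map_span:
  fixes M :: "'n::{finite,linorder} pointed_map"
  assumes "M \<in> stable_maps k d"
  obtains B where "vec.subspace B" "vec.dim B \<le> k + d"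
    "\<And>a p. a \<in> comps M \<Longrightarrow> p \<in> P1 \<Longrightarrow> cmap M a p \<subseteq> B"
proof -
  have cur: "prestable_curve M" and "map_of_degree k d M"
    using assms by (auto simp: stable_maps_def)
  then obtain deg where deg: "\<And>a. a \<in> comps M \<Longrightarrow> morphism_of_degree k (deg a) (cmap M a)"
    "(\<Sum>a\<in>comps M. deg a) = d" and
    glue: "\<And>N p q. N \<in> nodes M \<Longrightarrow> p \<in> N \<Longrightarrow> q \<in> N \<Longrightarrow> point_val M p = point_val M q"
    unfolding map_of_degree_def by blast
  have comps: "finite (comps M)" "comps M \<noteq> {}"
    and nodes: "\<And>N. N \<in> nodes M \<Longrightarrow> N \<subseteq> comps M \<times> P1"
    and conn: "\<And>a b. a \<in> comps M \<Longrightarrow> b \<in> comps M \<Longrightarrow> (a, b) \<in> (adjacent M)\<^sup>*"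
    using cur by (auto simp: prestable_curve_def)
  have one: "\<exists>B. vec.subspace B \<and> vec.dim B \<le> k + deg a \<and> (\<forall>p\<in>P1. cmap M a p \<subseteq> B)"
    if "a \<in> comps M" for a
    using rational_curve_span[OF deg(1)[OF that]] unfolding One_nat_def Ball_def P1_iff by blast
  let ?ok = "\<lambda>C B. C \<subseteq> comps M \<and> C \<noteq> {} \<and> vec.subspace B \<and> vec.dim B \<le> k + (\<Sum>a\<in>C. deg a) \<and>
    (\<forall>a\<in>C. \<forall>p\<in>P1. cmap M a p \<subseteq> B)"
  have grow: "\<exists>C B. ?ok C B \<and> card C = j" if "1 \<le> j" "j \<le> card (comps M)" for j
    using that
  proof (induction j rule: dec_induct)
    case base
    obtain a where a: "a \<in> comps M" using comps by blast
    then obtain B where "vec.subspace B" "vec.dim B \<le> k + deg a" "\<forall>p\<in>P1. cmap M a p \<subseteq> B"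
      using one by blast
    then have "?ok {a} B" using a by simp
    then show ?case by (metis is_singletonI is_singleton_altdef)
  next
    case (step j)
    then obtain C B where C: "?ok C B" "card C = j" by auto
    then have "C \<noteq> comps M" using step.prems by auto
    then obtain a b where ab: "a \<in> C" "b \<in> comps M" "b \<notin> C" using C by blast
    then have "(a, b) \<in> (adjacent M)\<^sup>*" using conn C(1) by blast
    from rtrancl_leaves[OF this ab(1,3)]
    obtain u v where uv: "(u, v) \<in> adjacent M" "u \<in> C" "v \<notin> C" by blast
    then obtain x y where xy: "{(u, x), (v, y)} \<in> nodes M" by (auto simp: adjacent_def)
    then have v: "v \<in> comps M" "x \<in> P1" "y \<in> P1" using nodes[OF xy] by auto
    have eq: "cmap M u x = cmap M v y"
      using glue[OF xy, of "(u, x)" "(v, y)"] by (simp add: point_val_def)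
    obtain B' where B': "vec.subspace B'" "vec.dim B' \<le> k + deg v" "\<forall>p\<in>P1. cmap M v p \<subseteq> B'"
      using one v(1) by blast
    have "vec.dim (cmap M v y) = k"
      using morphism_GrD(2)[OF deg(1)[OF v(1)]] v(3) by (auto simp: P1_iff)
    moreover have "cmap M v y \<subseteq> B" using C(1) uv(2) v(2) unfolding eq[symmetric] by blast
    moreover have "cmap M v y \<subseteq> B'" using B'(3) v(3) by blast
    ultimately have "vec.dim (B + B') + k \<le> vec.dim B + vec.dim B'"
      using dim_plus_common[of B B' "cmap M v y"] C(1) B'(1) by auto
    moreover have "finite C" using C(1) comps(1) finite_subset by blast
    moreover have "B \<subseteq> B + B'" "B' \<subseteq> B + B'" "vec.subspace (B + B')"
      using subspace_le_plus[of B B'] subspace_set_plus[of B B'] C(1) B'(1) by auto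
    moreover have "\<forall>a\<in>insert v C. \<forall>p\<in>P1. cmap M a p \<subseteq> B + B'"
    proof (intro ballI)
      fix a p assume "a \<in> insert v C" "p \<in> P1"
      then have "cmap M a p \<subseteq> B \<or> cmap M a p \<subseteq> B'" using C(1) B'(3) by blast
      then show "cmap M a p \<subseteq> B + B'" using \<open>B \<subseteq> B + B'\<close> \<open>B' \<subseteq> B + B'\<close> by blast
    qed
    moreover have "vec.dim B \<le> k + (\<Sum>a\<in>C. deg a)" "C \<subseteq> comps M" using C(1) by simp_all
    ultimately have "?ok (insert v C) (B + B')" "card (insert v C) = Suc j"
      using C(2) B'(2) uv(3) v(1) by simp_all
    then show ?case by blast
  qed
  have "1 \<le> card (comps M)" using comps by (simp add: Suc_le_eq card_gt_0_iff)
  from grow[OF this order.refl] obtain C where "\<exists>B. ?ok C B \<and> card C = card (comps M)" ..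
  then obtain B where CB: "?ok C B \<and> card C = card (comps M)" ..
  note C = conjunct1[OF CB] conjunct2[OF CB]
  have "C = comps M" using card_subset_eq[OF comps(1) _ C(2)] C(1) by simp
  then show thesis using C(1) deg(2) by (intro that[of B]) simp_all
qed

section \<open>Stable maps with a given main component\<close>

lemma constant_morphism:
  fixes V :: "(complex ^ 'n::{finite,linorder}) set"
  assumes "V \<in> Gr k"
  shows "morphism_of_degree k 0 (\<lambda>_. V)"
proof -
  obtain B where B: "B \<subseteq> V" "vec.independent B" "vec.span B = V" "card B = vec.dim V" "finite B"
    using basis_extending[of "{}" V] assms vec.independent_empty by (auto simp: Gr_def)
  then obtain vs where vs: "set vs = B" "distinct vs" using finite_distinct_list by blast
  then have "length vs = k" using B(4) assms distinct_card[of vs] by (simp add: Gr_def)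
  then have "plucker_coords k V (\<lambda>xs. binary_form 0 (\<lambda>_. minor vs xs) x)" for x
    unfolding plucker_coords_def using vs B by (intro exI[of _ vs]) (simp add: binary_form_def)
  then show ?thesis
    unfolding morphism_of_degree_def using assms
    by (intro exI[of _ "\<lambda>xs _. minor _ xs"]) blast
qed

text \<open>
Three given points of the main component may coincide, whereas marked points have to be distinct. In
that case the coinciding marked points are moved to a second component, attached at the point in
question and mapped to a single point of the Grassmannian. It carries the node and at least two marked
points, so the map is stable.
\<close>

lemma Gamma_curvesI:
  fixes f :: "(complex ^ 2) set \<Rightarrow> (complex ^ 'n::{finite,linorder}) set"
  assumes f: "morphism_of_degree k d f" "\<not> f constant_on P1"
    and x: "\<And>i. i \<in> {1..3} \<Longrightarrow> x i \<in> P1" and YZ: "f (x 1) \<in> Y" "f (x 2) \<in> Z"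
  shows "f (x (3::nat)) \<in> Gamma_curves k d Y Z"
proof (cases "inj_on x {1..3}")
  case True
  define M :: "'n pointed_map" where
    "M = \<lparr>comps = {0}, nodes = {}, mark = (\<lambda>i. (0, x i)), cmap = (\<lambda>_. f)\<rparr>"
  have "prestable_curve M"
    using x True by (auto simp: M_def prestable_curve_def inj_on_def)
  moreover have "map_of_degree k d M"
    using f(1) by (auto simp: M_def map_of_degree_def intro!: exI[of _ "\<lambda>_. d"])
  ultimately have "M \<in> stable_maps k d" using f(2) by (auto simp: stable_maps_def M_def)
  moreover have "ev i M = f (x i)" for i by (simp add: ev_def point_val_def M_def)
  ultimately show ?thesis unfolding Gamma_curves_def using YZ by (intro image_eqI[of _ _ M]) simp_all
next
  case False
  then obtain i j where ij: "i \<in> {1..3}" "j \<in> {1..3}" "i \<noteq> j" "x i = x j" by (auto simp: inj_on_def)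
  define x0 where "x0 = x i"
  have few: "l = m" if "l \<in> {1..3}" "m \<in> {1..3}" "x l \<noteq> x0" "x m \<noteq> x0" for l m
  proof -
    have "{1..3::nat} = {1,2,3}" by auto
    then show ?thesis using that ij by (auto simp: x0_def)
  qed
  \<comment> \<open>On the contracted component, \<open>q 0\<close> is the node and \<open>q i\<close> is the place for the marked point \<open>i\<close>.\<close>
  define q where "q = (\<lambda>m::nat. vec.span {vector [1, of_nat m] :: complex ^ 2})"
  have q: "q m \<in> P1" for m
    unfolding q_def One_nat_def P1_iff
    by (rule exI[of _ "vector [1, of_nat m]"]) (simp add: vec_eq_iff exI[of _ 1])
  have inj: "inj q"
  proof (rule injI)
    fix l m assume "q l = q m"
    then have "vector [1, of_nat l] \<in> vec.span {vector [1, of_nat m] :: complex ^ 2}"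
      unfolding q_def using vec.span_base by blast
    then obtain c where "vector [1, of_nat l] = c *s (vector [1, of_nat m] :: complex ^ 2)"
      by (auto simp: vec.span_singleton)
    then have "c = 1" "of_nat l = c * (of_nat m :: complex)" by (auto simp: vec_eq_iff forall_2)
    then show "l = m" by simp
  qed
  define N where "N = {(0 :: nat, x0), (1, q 0)}"
  define M :: "'n pointed_map" where
    "M = \<lparr>comps = {0, 1}, nodes = {N},
      mark = (\<lambda>i. if x i = x0 then (1, q i) else (0, x i)),
      cmap = (\<lambda>a. if a = 0 then f else (\<lambda>_. f x0))\<rparr>"
  have x0: "x0 \<in> P1" using x ij by (auto simp: x0_def)
  have adj: "(0, 1) \<in> adjacent M" "(1, 0) \<in> adjacent M"
    by (auto simp: adjacent_def M_def N_def)
  have conn: "(a, b) \<in> (adjacent M)\<^sup>*" if "a \<in> {0, 1}" "b \<in> {0, 1}" for a b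
    using that adj by auto
  have mark: "mark M l = (if x l = x0 then (1, q l) else (0, x l))" for l by (simp add: M_def)
  have "inj_on (mark M) {1..3}"
  proof (rule inj_onI)
    fix l m assume "l \<in> {1..3}" "m \<in> {1..3}" "mark M l = mark M m"
    then show "l = m" using few[of l m] inj by (auto simp: mark inj_eq split: if_splits)
  qed
  moreover have "mark M ` {1..3} \<subseteq> comps M \<times> P1 - \<Union>(nodes M)"
  proof (rule image_subsetI)
    fix l :: nat assume "l \<in> {1..3}"
    then show "mark M l \<in> comps M \<times> P1 - \<Union>(nodes M)"
      using x[of l] q[of l] inj_eq[OF inj, of l 0] by (simp add: mark) (simp add: M_def N_def)
  qed
  moreover have "N \<subseteq> {0, 1} \<times> P1" "card N = 2" using x0 q[of 0] by (simp_all add: N_def)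
  ultimately have "prestable_curve M"
    using conn unfolding prestable_curve_def by (simp add: M_def)
  moreover have "f x0 \<in> Gr k"
    using f(1) x0 by (auto simp: P1_iff morphism_of_degree_def)
  then have "map_of_degree k d M"
    using f(1) constant_morphism unfolding map_of_degree_def
    by (intro conjI exI[of _ "\<lambda>a. if a = 0 then d else 0"])
       (auto simp: M_def N_def point_val_def)
  moreover have "card (special_points M 1) \<ge> 3"
  proof -
    have "special_points M 1 \<subseteq> q ` {0..3}"
      by (auto simp: special_points_def M_def N_def split: if_splits)
    then have "finite (special_points M 1)" using finite_subset by blast
    moreover have "q ` {0, i, j} \<subseteq> special_points M 1"
      using ij by (force simp: special_points_def M_def N_def x0_def image_iff)
    moreover have "card (q ` {0, i, j}) = 3"
      using card_image[OF inj_on_subset[OF inj subset_UNIV], of "{0, i, j}"] ij by auto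
    ultimately show ?thesis using card_mono by metis
  qed
  ultimately have "M \<in> stable_maps k d"
    using f(2) by (auto simp: stable_maps_def M_def)
  moreover have "ev i M = f (x i)" for i by (simp add: ev_def point_val_def M_def)
  ultimately show ?thesis unfolding Gamma_curves_def using YZ by (intro image_eqI[of _ _ M]) simp_all
qed

section \<open>Rational curves with prescribed rows\<close>

definition is_form :: "nat \<Rightarrow> (complex ^ 2 \<Rightarrow> complex) \<Rightarrow> bool" where
  "is_form d g \<longleftrightarrow> (\<exists>c. \<forall>x. g x = binary_form d c x)"

lemma is_form_monomial: "is_form (i + j) (\<lambda>x. a * (x $ 1) ^ i * (x $ 2) ^ j)"
proof -
  have "binary_form (i + j) (\<lambda>m. if m = i then a else 0) x = a * (x $ 1) ^ i * (x $ 2) ^ j" for x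
    by (simp add: binary_form_def if_distrib[of "\<lambda>a. a * _"] sum.delta cong: if_cong)
  then show ?thesis unfolding is_form_def by metis
qed

lemma is_form_sum:
  assumes "\<And>i. i \<in> A \<Longrightarrow> is_form d (g i)"
  shows "is_form d (\<lambda>x. \<Sum>i\<in>A. a i * g i x)"
proof -
  obtain c where c: "\<And>i x. i \<in> A \<Longrightarrow> g i x = binary_form d (c i) x"
    using assms unfolding is_form_def by metis
  then have "(\<Sum>i\<in>A. a i * g i x) = binary_form d (\<lambda>m. \<Sum>i\<in>A. a i * c i m) x" for x
    unfolding binary_form_sum[symmetric] by simp
  then show ?thesis unfolding is_form_def by blast
qed

lemma is_form_add:
  assumes "is_form d g" "is_form d h"
  shows "is_form d (\<lambda>x. g x + h x)"
  using is_form_sum[of "{True, False}" d "\<lambda>b. if b then g else h" "\<lambda>_. 1"] assms by simp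

lemma is_form_mult:
  assumes "is_form d g" "is_form d' h"
  shows "is_form (d + d') (\<lambda>x. g x * h x)"
proof -
  obtain b c where b: "\<And>x. g x = binary_form d b x" and c: "\<And>x. h x = binary_form d' c x"
    using assms unfolding is_form_def by blast
  have "g x * h x = (\<Sum>(m, l)\<in>{..d} \<times> {..d'}. b m * c l * (1 * (x $ 1) ^ (m + l) * (x $ 2) ^ ((d - m) + (d' - l))))" for x
    by (simp add: b c binary_form_def sum_product sum.cartesian_product power_add mult_ac)
  moreover have "is_form (d + d') (\<lambda>x. 1 * (x $ 1) ^ (m + l) * (x $ 2) ^ ((d - m) + (d' - l)))"
    if "m \<le> d" "l \<le> d'" for m l
  proof -
    have "(m + l) + ((d - m) + (d' - l)) = d + d'" using that by simp
    then show ?thesis using is_form_monomial[of "m + l" "(d - m) + (d' - l)" 1] by simp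
  qed
  ultimately show ?thesis
    using is_form_sum[of "{..d} \<times> {..d'}" "d + d'"
        "\<lambda>(m, l) x. 1 * (x $ 1) ^ (m + l) * (x $ 2) ^ ((d - m) + (d' - l))" "\<lambda>(m, l). b m * c l"]
    by (auto simp: case_prod_unfold)
qed

lemma is_form_prod:
  assumes "finite A" "\<And>i. i \<in> A \<Longrightarrow> is_form (r i) (g i)"
  shows "is_form (\<Sum>i\<in>A. r i) (\<lambda>x. \<Prod>i\<in>A. g i x)"
  using assms
proof (induction rule: finite_induct)
  case empty
  show ?case using is_form_monomial[of 0 0 1] by simp
next
  case (insert i A)
  then show ?case using is_form_mult by simp
qed

lemma is_form_scale:
  assumes "is_form d g"
  shows "g (a *s x) = a ^ d * g x"
proof -
  obtain c where c: "\<And>x. g x = binary_form d c x" using assms unfolding is_form_def by blast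
  have pow: "a ^ d = a ^ m * a ^ (d - m)" if "m \<le> d" for m
    using that by (simp add: power_add[symmetric])
  show ?thesis
    unfolding c binary_form_def sum_distrib_left
    by (intro sum.cong refl) (simp add: pow power_mult_distrib mult_ac)
qed

text \<open>
The union over all vectors of the line avoids the choice of a representative; for rows that are
homogeneous any nonzero vector of the line gives the same span.
\<close>

definition row_curve :: "('i \<Rightarrow> complex ^ 2 \<Rightarrow> complex ^ 'n) \<Rightarrow> 'i set \<Rightarrow> (complex ^ 2) set \<Rightarrow> (complex ^ 'n) set" where
  "row_curve R I L = vec.span (\<Union>x\<in>L. (\<lambda>i. R i x) ` I)"

lemma row_curve_span:
  assumes form: "\<And>i j. i \<in> I \<Longrightarrow> is_form (r i) (\<lambda>x. R i x $ j)"
  shows "row_curve R I (vec.span {x}) = vec.span ((\<lambda>i. R i x) ` I)"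
proof -
  have "R i (a *s x) = a ^ r i *s R i x" if "i \<in> I" for i a
    using is_form_scale[OF form[OF that]] by (simp add: vec_eq_iff)
  moreover have "R i x \<in> vec.span ((\<lambda>i. R i x) ` I)" if "i \<in> I" for i
    using that by (intro vec.span_base) simp
  ultimately have "R i y \<in> vec.span ((\<lambda>i. R i x) ` I)" if "i \<in> I" "y \<in> vec.span {x}" for i y
    using that by (auto simp: vec.span_singleton intro!: vec.span_scale)
  then have "(\<Union>y\<in>vec.span {x}. (\<lambda>i. R i y) ` I) \<subseteq> vec.span ((\<lambda>i. R i x) ` I)" by blast
  moreover have "(\<lambda>i. R i x) ` I \<subseteq> (\<Union>y\<in>vec.span {x}. (\<lambda>i. R i y) ` I)"
    using vec.span_base[of x "{x}"] by blast
  ultimately show ?thesis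
    unfolding row_curve_def by (intro subset_antisym vec.span_minimal vec.span_mono) auto
qed

text \<open>
The minors of the matrix of rows are sums of products of one entry from each row, so the degrees of
the rows add up.
\<close>

lemma row_curve_morphism:
  fixes R :: "'i \<Rightarrow> complex ^ 2 \<Rightarrow> complex ^ 'n::{finite,linorder}"
  assumes I: "finite I"
    and form: "\<And>i j. i \<in> I \<Longrightarrow> is_form (r i) (\<lambda>x. R i x $ j)"
    and indep: "\<And>x u. x \<noteq> 0 \<Longrightarrow> (\<Sum>i\<in>I. u i *s R i x) = 0 \<Longrightarrow> \<forall>i\<in>I. u i = 0"
  shows "morphism_of_degree (card I) (\<Sum>i\<in>I. r i) (row_curve R I)"
proof -
  obtain js where js: "set js = I" "distinct js" using finite_distinct_list[OF I] by blast
  define vs where "vs = (\<lambda>x. map (\<lambda>i. R i x) js)"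
  have nth: "(\<Sum>a<length js. r (js ! a)) = (\<Sum>i\<in>I. r i)"
    using sum.reindex_bij_betw[OF bij_betw_nth[OF js(2) refl], of I r] js(1) by simp
  have len: "length (vs x) = length js" for x by (simp add: vs_def)
  have "is_form (\<Sum>a<length js. r (js ! a)) (\<lambda>x. minor (vs x) xs)" for xs
    unfolding minor_def len
  proof (intro is_form_sum is_form_prod)
    fix p a assume "a \<in> {..<length js}"
    then show "is_form (r (js ! a)) (\<lambda>x. vs x ! a $ (xs ! p a))"
      using form[of "js ! a"] js(1) nth_mem[of a js] by (simp add: vs_def)
  qed simp
  then have "\<exists>c. \<forall>x. minor (vs x) xs = binary_form (\<Sum>i\<in>I. r i) c x" for xs
    unfolding is_form_def nth by blast
  then obtain c where c: "\<And>xs x. minor (vs x) xs = binary_form (\<Sum>i\<in>I. r i) (c xs) x" by metis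
  have "row_curve R I (vec.span {x}) \<in> Gr (card I) \<and>
      plucker_coords (card I) (row_curve R I (vec.span {x})) (\<lambda>xs. binary_form (\<Sum>i\<in>I. r i) (c xs) x)"
    if x: "x \<noteq> 0" for x
  proof -
    have inj: "inj_on (\<lambda>i. R i x) I"
    proof (rule inj_onI, rule ccontr)
      fix i j assume ij: "i \<in> I" "j \<in> I" "R i x = R j x" "i \<noteq> j"
      let ?u = "\<lambda>l. (if l = i then 1 else 0) - (if l = j then 1 else 0) :: complex"
      have "(\<Sum>l\<in>I. ?u l *s R l x) = (\<Sum>l\<in>I. (if l = i then R i x else 0) - (if l = j then R j x else 0))"
        by (intro sum.cong refl) (auto simp: vec.scale_left_diff_distrib)
      also have "\<dots> = 0" using ij I by (simp add: sum_subtractf)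
      finally have "?u i = 0" using indep[OF x, of ?u] ij(1) by blast
      then show False using ij(4) by simp
    qed
    have ind: "vec.independent ((\<lambda>i. R i x) ` I)"
    proof (rule vec.independent_if_scalars_zero)
      fix g w assume "(\<Sum>v\<in>(\<lambda>i. R i x) ` I. g v *s v) = 0" "w \<in> (\<lambda>i. R i x) ` I"
      then show "g w = 0"
        using indep[OF x, of "\<lambda>i. g (R i x)"] by (auto simp: sum.reindex[OF inj])
    qed (use I in simp)
    have sp: "row_curve R I (vec.span {x}) = vec.span ((\<lambda>i. R i x) ` I)"
      by (rule row_curve_span) (rule form)
    have card: "card ((\<lambda>i. R i x) ` I) = card I" by (rule card_image[OF inj])
    have "row_curve R I (vec.span {x}) \<in> Gr (card I)"
      unfolding sp Gr_def using vec.dim_span_eq_card_independent[OF ind] card by simp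
    moreover have "set (vs x) = (\<lambda>i. R i x) ` I" "length (vs x) = card I" "distinct (vs x)"
      using js inj by (auto simp: vs_def distinct_map distinct_card)
    ultimately show ?thesis
      unfolding plucker_coords_def sp c[symmetric] using ind by (intro conjI exI[of _ "vs x"]) auto
  qed
  then show ?thesis unfolding morphism_of_degree_def by blast
qed

section \<open>Curves through two points and a vector\<close>

text \<open>
Let \<open>e\<close> be the codimension of \<open>V \<inter> V'\<close> in \<open>V\<close>. Bases of \<open>V\<close> and \<open>V'\<close> that extend a common basis
\<open>SA\<close> of \<open>V \<inter> V'\<close> are matched by a bijection \<open>\<beta>\<close> with \<open>\<beta> a = b\<close>. The curve is spanned at \<open>(s, t)\<close> by
\<open>SA\<close>, the vectors \<open>s w + t \<beta> w\<close> for the \<open>e - 1\<close> basis vectors \<open>w \<noteq> a\<close>, and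
\<open>s\<^sup>r a + t\<^sup>r b + s t\<^bsup>r-1\<^esup> c\<close> with \<open>r = d - e + 1\<close>. The exponent \<open>r\<close> makes the degree equal to \<open>d\<close> and not
just at most \<open>d\<close>; the bound on the dimension gives \<open>r \<ge> 1\<close>, and \<open>r \<ge> 2\<close> if \<open>c \<noteq> 0\<close>, so that the term
with \<open>c\<close> vanishes at the two end points.
\<close>

lemma curve_through:
  fixes V V' :: "(complex ^ 'n::{finite,linorder}) set"
  assumes V: "V \<in> Gr k" "V' \<in> Gr k" and a: "a \<in> V" "a \<notin> V'" and b: "b \<in> V'" "b \<notin> V"
    and c: "c = 0 \<or> c \<notin> V + V'" and dim: "vec.dim (V + V' + vec.span {c}) \<le> k + d"
  obtains f where "morphism_of_degree k d f"
    "f (vec.span {vector [1, 0]}) = V" "f (vec.span {vector [0, 1]}) = V'"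
    "a + b + c \<in> f (vec.span {vector [1, 1]})"
proof -
  have sub: "vec.subspace V" "vec.subspace V'" "vec.subspace (V \<inter> V')" "vec.subspace (V + V')"
    and dims: "vec.dim V = k" "vec.dim V' = k"
    using V by (auto simp: Gr_def vec.subspace_inter subspace_set_plus)
  obtain SA where "finite SA" "SA \<subseteq> V \<inter> V'" "vec.independent SA" "vec.span SA = V \<inter> V'"
    "card SA = vec.dim (V \<inter> V')"
    by (rule vec.basis_subspace_exists[OF sub(3)])
  note SA = this(2-4,1,5)
  have ins: "vec.independent (insert a SA)" "vec.independent (insert b SA)"
      "insert a SA \<subseteq> V" "insert b SA \<subseteq> V'"
    using SA(1-3) a b by (simp_all add: vec.independent_insert)
  obtain SV where SV: "insert a SA \<subseteq> SV" "SV \<subseteq> V" "vec.independent SV" "vec.span SV = V"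
      "card SV = k" "finite SV"
    by (rule basis_extending[OF ins(1,3) sub(1), unfolded dims])
  obtain SW where SW: "insert b SA \<subseteq> SW" "SW \<subseteq> V'" "vec.independent SW" "vec.span SW = V'"
      "card SW = k" "finite SW"
    by (rule basis_extending[OF ins(2,4) sub(2), unfolded dims])
  define SP where "SP = SV - SA"
  define SQ where "SQ = SW - SA"
  define e where "e = card SP"
  have aP: "a \<in> SP" using SV(1) SA(1) a(2) by (auto simp: SP_def)
  have bQ: "b \<in> SQ" using SW(1) SA(1) b(2) by (auto simp: SQ_def)
  have fin: "finite SP" "finite SQ" using SV(6) SW(6) by (simp_all add: SP_def SQ_def)
  have SVeq: "SV = SA \<union> SP" "SA \<inter> SP = {}" and SWeq: "SW = SA \<union> SQ" "SA \<inter> SQ = {}"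
    using SV(1) SW(1) by (auto simp: SP_def SQ_def)
  have cards: "card SA + e = k" "card SQ = e"
    using card_Un_disjoint[OF SA(4) fin(1) SVeq(2)] card_Un_disjoint[OF SA(4) fin(2) SWeq(2)]
      SV(5) SW(5) SVeq(1) SWeq(1) by (simp_all add: e_def)
  obtain \<beta>' where \<beta>': "bij_betw \<beta>' (SP - {a}) (SQ - {b})"
    using finite_same_card_bij[of "SP - {a}" "SQ - {b}"] fin aP bQ cards(2) by (auto simp: e_def)
  define \<beta> where "\<beta> = \<beta>'(a := b)"
  have \<beta>: "bij_betw \<beta> SP SQ"
  proof -
    have "bij_betw \<beta> (SP - {a}) (SQ - {b})"
      using \<beta>' by (subst bij_betw_cong[of _ \<beta> \<beta>']) (auto simp: \<beta>_def)
    moreover have "bij_betw \<beta> {a} {b}" by (simp add: bij_betw_def \<beta>_def)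
    ultimately have "bij_betw \<beta> (SP - {a} \<union> {a}) (SQ - {b} \<union> {b})"
      by (rule bij_betw_combine) auto
    then show ?thesis using aP bQ by (simp add: insert_absorb)
  qed
  have dimVV: "vec.dim (V + V') = k + e"
    using dim_plus_Int[OF sub(1,2)] dims cards(1) SA(5) by linarith
  let ?SU = "SV \<union> SQ"
  have spU: "vec.span ?SU = V + V'"
  proof -
    have "vec.span ?SU = vec.span (SV \<union> SW)" using SVeq SWeq by (intro arg_cong[where f = vec.span]) auto
    then show ?thesis using SV(4) SW(4) by (auto simp: vec.span_Un set_plus_def)
  qed
  have SUsub: "?SU \<subseteq> V + V'" using vec.span_superset spU by metis
  have cardU: "card ?SU + card (SV \<inter> SQ) = k + e"
    using card_Un_Int[OF SV(6) fin(2)] SV(5) cards(2) by simp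
  have indU: "vec.independent ?SU"
    by (rule vec.card_le_dim_spanning[OF SUsub]) (use spU SV(6) fin cardU dimVV in auto)
  have "card ?SU = k + e"
    using vec.dim_span_eq_card_independent[OF indU] spU dimVV by simp
  then have dis: "SV \<inter> SQ = {}" using cardU SV(6) by simp
  define r0 where "r0 = d - e + 1"
  define r where "r = (\<lambda>w. if w \<in> SA then 0 else if w = a then r0 else 1)"
  define R where "R = (\<lambda>w (x :: complex ^ 2). if w \<in> SA then w
     else (x $ 1) ^ r w *s w + (x $ 2) ^ r w *s \<beta> w + (if w = a then (x $ 1 * (x $ 2) ^ (r0 - 1)) *s c else 0))"
  have ed: "e \<le> d"
    using dim dimVV vec.dim_subset[OF subspace_le_plus(1)[OF sub(4) vec.subspace_span[of "{c}"]]] by linarith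
  have r0: "r0 \<ge> 2" if "c \<noteq> 0"
    using that c dim dimVV dim_plus_line[OF sub(4), of c] by (simp add: r0_def)
  have r0': "r0 \<ge> 1" by (simp add: r0_def)
  have form: "is_form (r w) (\<lambda>x. R w x $ j)" for w j
  proof (cases "w \<in> SA")
    case True
    then show ?thesis using is_form_monomial[of 0 0 "w $ j"] by (simp add: r_def R_def)
  next
    case False
    have 1: "is_form (r w) (\<lambda>x. (x $ 1) ^ r w * w $ j + (x $ 2) ^ r w * \<beta> w $ j)"
      using is_form_add[OF is_form_monomial[of "r w" 0 "w $ j"], of "\<lambda>x. \<beta> w $ j * (x $ 1) ^ 0 * (x $ 2) ^ r w"]
        is_form_monomial[of 0 "r w" "\<beta> w $ j"] by (simp add: mult_ac)
    show ?thesis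
    proof (cases "w = a")
      case True
      have "is_form (r w) (\<lambda>x. c $ j * (x $ 1) ^ 1 * (x $ 2) ^ (r0 - 1))"
        using is_form_monomial[of 1 "r0 - 1" "c $ j"] r0' True False by (simp add: r_def)
      from is_form_add[OF 1 this] show ?thesis using False True by (simp add: R_def mult_ac)
    next
      case ne: False
      then show ?thesis using 1 False by (simp add: R_def)
    qed
  qed
  have indep: "\<forall>w\<in>SV. u w = 0" if x: "x \<noteq> 0" and sum0: "(\<Sum>w\<in>SV. u w *s R w x) = 0" for x u
  proof -
    define z where "z = (\<Sum>w\<in>SA. u w *s w) + (\<Sum>w\<in>SP. (u w * (x $ 1) ^ r w) *s w)
        + (\<Sum>w\<in>SP. (u w * (x $ 2) ^ r w) *s \<beta> w)"
    define m where "m = u a * (x $ 1 * (x $ 2) ^ (r0 - 1))"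
    have "(\<Sum>w\<in>SV. u w *s R w x) = (\<Sum>w\<in>SA. u w *s R w x) + (\<Sum>w\<in>SP. u w *s R w x)"
      unfolding SVeq(1) by (rule sum.union_disjoint[OF SA(4) fin(1) SVeq(2)])
    also have "(\<Sum>w\<in>SA. u w *s R w x) = (\<Sum>w\<in>SA. u w *s w)" by (simp add: R_def)
    also have "(\<Sum>w\<in>SP. u w *s R w x) = (\<Sum>w\<in>SP. (u w * (x $ 1) ^ r w) *s w
        + (u w * (x $ 2) ^ r w) *s \<beta> w + (if w = a then m *s c else 0))"
      using SVeq(2) by (intro sum.cong refl) (auto simp: R_def m_def vec.scale_right_distrib)
    also have "\<dots> = (\<Sum>w\<in>SP. (u w * (x $ 1) ^ r w) *s w) + (\<Sum>w\<in>SP. (u w * (x $ 2) ^ r w) *s \<beta> w) + m *s c"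
      using fin aP by (simp add: sum.distrib)
    finally have zc: "z + m *s c = 0" using sum0 by (simp add: z_def add_ac)
    have reQ: "(\<Sum>w\<in>SP. h w *s \<beta> w) = (\<Sum>w\<in>SQ. h (the_inv_into SP \<beta> w) *s w)" for h
      using sum.reindex_bij_betw[OF \<beta>, of "\<lambda>w. h (the_inv_into SP \<beta> w) *s w"] \<beta>
      by (simp add: the_inv_into_f_f bij_betw_def cong: sum.cong)
    define g where "g = (\<lambda>w. if w \<in> SA then u w else if w \<in> SP then u w * (x $ 1) ^ r w
        else u (the_inv_into SP \<beta> w) * (x $ 2) ^ r (the_inv_into SP \<beta> w))"
    have "(\<Sum>w\<in>?SU. g w *s w) = (\<Sum>w\<in>SA. g w *s w) + (\<Sum>w\<in>SP. g w *s w) + (\<Sum>w\<in>SQ. g w *s w)"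
      using sum.union_disjoint[OF SV(6) fin(2) dis, of "\<lambda>w. g w *s w"]
        sum.union_disjoint[OF SA(4) fin(1) SVeq(2), of "\<lambda>w. g w *s w"] SVeq(1) by simp
    also have "\<dots> = z"
    proof -
      have "(\<Sum>w\<in>SA. g w *s w) = (\<Sum>w\<in>SA. u w *s w)" by (simp add: g_def)
      moreover have "(\<Sum>w\<in>SP. g w *s w) = (\<Sum>w\<in>SP. (u w * (x $ 1) ^ r w) *s w)"
        using SVeq(2) by (intro sum.cong refl) (auto simp: g_def)
      moreover have "(\<Sum>w\<in>SQ. g w *s w) = (\<Sum>w\<in>SP. (u w * (x $ 2) ^ r w) *s \<beta> w)"
        unfolding reQ using dis SVeq SWeq(2) by (intro sum.cong refl) (auto simp: g_def)
      ultimately show ?thesis by (simp add: z_def)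
    qed
    finally have gz: "(\<Sum>w\<in>?SU. g w *s w) = z" .
    have "z \<in> V + V'"
      unfolding gz[symmetric] spU[symmetric] by (intro vec.span_sum vec.span_scale vec.span_base)
    \<comment> \<open>The term with \<open>c\<close> has to vanish by itself, since \<open>c\<close> is \<open>0\<close> or independent of \<open>V + V'\<close>.\<close>
    have "m *s c = 0"
    proof (cases "c = 0")
      case False
      have "m = 0"
      proof (rule ccontr)
        assume "m \<noteq> 0"
        have "m *s c = - z" using zc by (simp add: eq_neg_iff_add_eq_0 add.commute)
        then have "inverse m *s (m *s c) \<in> V + V'"
          using \<open>z \<in> V + V'\<close> sub(4) vec.subspace_neg vec.subspace_scale by metis
        then have "c \<in> V + V'" using \<open>m \<noteq> 0\<close> by (simp add: vector_smult_assoc del: vec.scale_scale)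
        then show False using c False by blast
      qed
      then show ?thesis by simp
    qed simp
    with zc have "z = 0" by (metis add.right_neutral)
    then have "(\<Sum>w\<in>?SU. g w *s w) = 0" using gz by simp
    then have g0: "g w = 0" if "w \<in> ?SU" for w
      using that indU unfolding vec.independent_explicit by blast
    have x12: "x $ 1 \<noteq> 0 \<or> x $ 2 \<noteq> 0" using x by (auto simp: vec_eq_iff forall_2)
    show ?thesis
    proof
      fix w assume "w \<in> SV"
      then consider "w \<in> SA" | "w \<in> SP" "w \<notin> SA" using SVeq by blast
      then show "u w = 0"
      proof cases
        case 1
        then show ?thesis using g0[of w] SVeq(1) by (simp add: g_def)
      next
        case 2
        then have "\<beta> w \<in> SQ" using \<beta> by (auto simp: bij_betw_def)
        moreover have "the_inv_into SP \<beta> (\<beta> w) = w" using \<beta> 2 by (simp add: the_inv_into_f_f bij_betw_def)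
        ultimately have "u w * (x $ 2) ^ r w = 0"
          using g0[of "\<beta> w"] dis SVeq SWeq(2) by (auto simp: g_def split: if_splits)
        moreover have "u w * (x $ 1) ^ r w = 0" using g0[of w] 2 SVeq(1) by (simp add: g_def)
        ultimately show ?thesis using x12 by auto
      qed
    qed
  qed
  have deg: "(\<Sum>w\<in>SV. r w) = d"
  proof -
    have "(\<Sum>w\<in>SV. r w) = (\<Sum>w\<in>SA. r w) + (\<Sum>w\<in>SP. r w)"
      unfolding SVeq(1) by (rule sum.union_disjoint[OF SA(4) fin(1) SVeq(2)])
    also have "(\<Sum>w\<in>SA. r w) = 0" by (simp add: r_def)
    also have "(\<Sum>w\<in>SP. r w) = r0 + (\<Sum>w\<in>SP - {a}. r w)"
      using sum.remove[OF fin(1) aP, of r] aP SVeq(2) by (auto simp: r_def)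
    also have "(\<Sum>w\<in>SP - {a}. r w) = (\<Sum>w\<in>SP - {a}. 1)"
      using SVeq(2) by (intro sum.cong refl) (auto simp: r_def)
    also have "0 + (r0 + (\<Sum>w\<in>SP - {a}. 1)) = d"
    proof -
      have "card (SP - {a}) = e - 1" using aP fin by (simp add: e_def)
      moreover have "e \<ge> 1" using aP fin by (auto simp: e_def Suc_le_eq card_gt_0_iff)
      ultimately show ?thesis using ed by (simp add: r0_def)
    qed
    finally show ?thesis .
  qed
  have mor: "morphism_of_degree k d (row_curve R SV)"
  proof -
    have "morphism_of_degree (card SV) (\<Sum>w\<in>SV. r w) (row_curve R SV)"
      by (rule row_curve_morphism[OF SV(6)]) (rule form, rule indep)
    then show ?thesis by (simp only: deg SV(5))
  qed
  have rpos: "r w \<ge> 1" if "w \<in> SP" for w using that SVeq(2) r0' by (auto simp: r_def)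
  have c_zero: "(0 :: complex) ^ (r0 - 1) *s c = 0"
    using r0 by (cases "c = 0") auto
  have R10: "R w (vector [1, 0]) = w" if "w \<in> SV" for w
  proof (cases "w \<in> SA")
    case False
    then have "w \<in> SP" using that SVeq by blast
    from rpos[OF this] show ?thesis using False c_zero by (simp add: R_def power_0_left)
  qed (simp add: R_def)
  have R01: "R w (vector [0, 1]) = (if w \<in> SA then w else \<beta> w)" if "w \<in> SV" for w
  proof (cases "w \<in> SA")
    case False
    then have "w \<in> SP" using that SVeq by blast
    from rpos[OF this] show ?thesis using False by (simp add: R_def power_0_left)
  qed (simp add: R_def)
  have spans: "row_curve R SV (vec.span {x}) = vec.span ((\<lambda>w. R w x) ` SV)" for x
    by (rule row_curve_span) (rule form)
  show thesis
  proof (rule that[OF mor])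
    show "row_curve R SV (vec.span {vector [1, 0]}) = V"
      unfolding spans using R10 SV(4) by simp
    have "(\<lambda>w. R w (vector [0, 1])) ` SV = SA \<union> \<beta> ` SP"
      using R01 SVeq by (auto simp: image_iff)
    then show "row_curve R SV (vec.span {vector [0, 1]}) = V'"
      unfolding spans using \<beta> SW(4) SWeq(1) by (simp add: bij_betw_def)
    have "R a (vector [1, 1]) = a + b + c"
      using aP SVeq(2) by (auto simp: R_def \<beta>_def)
    moreover have "R a (vector [1, 1]) \<in> vec.span ((\<lambda>w. R w (vector [1, 1])) ` SV)"
      using aP SVeq(1) by (intro vec.span_base) simp
    ultimately show "a + b + c \<in> row_curve R SV (vec.span {vector [1, 1]})"
      unfolding spans by simp
  qed
qed

section \<open>Quantum equals classical\<close>

text \<open>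
If \<open>V \<noteq> V'\<close>, the value of the curve of \<open>curve_through\<close> at \<open>(1, 1)\<close> can be made to contain \<open>v\<close>: either
\<open>v\<close> is the sum of vectors \<open>a\<close> and \<open>b\<close> that are allowed there, or \<open>v\<close> is outside \<open>V + V'\<close> and \<open>c\<close> makes
up for the difference. A vector of \<open>V\<close> or \<open>V'\<close> is already contained in the value at an end point. If
\<open>V = V'\<close>, any other end point will do, as long as it contains \<open>v\<close> when \<open>V\<close> does not.
\<close>

lemma curve_incident_to_vector:
  fixes V V' :: "(complex ^ 'n::{finite,linorder}) set"
  assumes V: "V \<in> Gr k" "V' \<in> Gr k" and k: "1 \<le> k" "k < CARD('n)" and d: "1 \<le> d"
    and dim: "vec.dim (V + V' + vec.span {v}) \<le> k + d"
  obtains f x1 x2 x3 where "morphism_of_degree k d f" "\<not> f constant_on P1"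
    "x1 \<in> P1" "x2 \<in> P1" "x3 \<in> P1" "v \<in> f x1" "f x2 = V'" "f x3 = V"
proof -
  let ?p = "\<lambda>s t. vec.span {vector [s, t] :: complex ^ 2}"
  have "?p s t \<in> P1" if "s \<noteq> 0 \<or> t \<noteq> 0" for s t
    unfolding One_nat_def P1_iff using that
    by (intro exI[of _ "vector [s, t]"]) (auto simp: vec_eq_iff forall_2)
  then have pts: "?p 1 0 \<in> P1" "?p 0 1 \<in> P1" "?p 1 1 \<in> P1" by simp_all
  have nonconst: "\<not> f constant_on P1" if "f (?p 1 0) \<noteq> f (?p 0 1)" for f :: "_ \<Rightarrow> (complex, 'n) vec set"
    using that pts unfolding constant_on_def by metis
  have sub: "vec.subspace V" "vec.subspace V'" "vec.subspace (V + V')"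
    and dims: "vec.dim V = k" "vec.dim V' = k"
    using V by (auto simp: Gr_def subspace_set_plus)
  show thesis
  proof (cases "V = V'")
    case False
    have "\<not> V \<subseteq> V'" "\<not> V' \<subseteq> V"
      using False subspace_eqI[OF sub(1,2)] subspace_eqI[OF sub(2,1)] dims by auto
    then obtain a b where ab: "a \<in> V" "a \<notin> V'" "b \<in> V'" "b \<notin> V" by blast
    have "V + V' + vec.span {0} \<subseteq> V + V' + vec.span {v}"
      by (intro set_plus_mono2 vec.span_minimal) (auto intro: vec.span_zero)
    then have dim0: "vec.dim (V + V' + vec.span {0}) \<le> k + d"
      using vec.dim_subset dim order.trans by blast
    consider "v \<in> V" | "v \<in> V'" | "v \<notin> V" "v \<notin> V'" "v \<in> V + V'" | "v \<notin> V + V'" by blast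
    then show thesis
    proof cases
      case 1
      obtain f where f: "morphism_of_degree k d f" "f (?p 1 0) = V" "f (?p 0 1) = V'"
        using curve_through[OF V ab _ dim0] by blast
      then show thesis
        using that[of f "?p 1 0" "?p 0 1" "?p 1 0"] pts nonconst[of f] False 1 by simp
    next
      case 2
      obtain f where f: "morphism_of_degree k d f" "f (?p 1 0) = V" "f (?p 0 1) = V'"
        using curve_through[OF V ab _ dim0] by blast
      then show thesis
        using that[of f "?p 0 1" "?p 0 1" "?p 1 0"] pts nonconst[of f] False 2 by simp
    next
      case 3
      then obtain a' b' where v: "v = a' + b'" "a' \<in> V" "b' \<in> V'" by (auto simp: set_plus_def)
      have "a' \<notin> V'" using v 3(2) vec.subspace_add[OF sub(2)] by blast
      moreover have "b' \<notin> V" using v 3(1) vec.subspace_add[OF sub(1)] by blast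
      ultimately obtain f where f: "morphism_of_degree k d f" "f (?p 1 0) = V" "f (?p 0 1) = V'"
          "a' + b' + 0 \<in> f (?p 1 1)"
        using curve_through[OF V v(2) _ v(3) _ _ dim0] by blast
      then show thesis
        using that[of f "?p 1 1" "?p 0 1" "?p 1 0"] pts nonconst[of f] False v(1) by simp
    next
      case 4
      define c where "c = v - a - b"
      have "a + b \<in> V + V'" using ab by (auto simp: set_plus_def)
      then have c: "c \<notin> V + V'"
        using 4 vec.subspace_add[OF sub(3), of c "a + b"] by (auto simp: c_def)
      have "vec.dim (V + V' + vec.span {c}) \<le> k + d"
        using dim c 4 by (simp add: dim_plus_line[OF sub(3)])
      then obtain f where f: "morphism_of_degree k d f" "f (?p 1 0) = V" "f (?p 0 1) = V'"
          "a + b + c \<in> f (?p 1 1)"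
        using curve_through[OF V ab disjI2[OF c]] by blast
      then show thesis
        using that[of f "?p 1 1" "?p 0 1" "?p 1 0"] pts nonconst[of f] False by (simp add: c_def)
    qed
  next
    case True
    have "V \<noteq> UNIV" using dims(1) k(2) vec_dim_card[where 'a = complex and 'n = 'n] by auto
    then obtain w where w: "w \<notin> V" "v \<notin> V \<Longrightarrow> w = v" by (cases "v \<in> V") auto
    obtain H where H: "vec.subspace H" "H \<subseteq> V" "vec.dim H = k - 1"
      by (rule subspace_between[of "{0}" V "k - 1"])
         (use sub(1) dims(1) k(1) vec.subspace_0 in auto)
    let ?W = "H + vec.span {w}"
    have "w \<notin> H" using w(1) H(2) by blast
    then have W: "?W \<in> Gr k"
      using H(1,3) k(1) by (simp add: Gr_def subspace_set_plus dim_plus_line)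
    have wW: "w \<in> ?W"
      using subspace_le_plus(2)[OF H(1) vec.subspace_span[of "{w}"]] vec.span_base[of w "{w}"] by blast
    have subW: "vec.subspace ?W" and dimW: "vec.dim ?W = k" using W by (auto simp: Gr_def)
    have "\<not> V \<subseteq> ?W" using wW w(1) subspace_eqI[OF sub(1) subW] dims(1) dimW by auto
    then obtain a where a: "a \<in> V" "a \<notin> ?W" by blast
    have subVw: "vec.subspace (V + vec.span {w})" using sub(1) by (simp add: subspace_set_plus)
    have "V + ?W + vec.span {0} \<subseteq> V + vec.span {w}"
      using H(2) subVw subspace_le_plus[OF sub(1) vec.subspace_span[of "{w}"]] vec.span_base[of w "{w}"]
      by (intro subspace_plus_least vec.span_minimal) (auto simp: vec.subspace_0)
    then have "vec.dim (V + ?W + vec.span {0}) \<le> k + 1"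
      using vec.dim_subset[of "V + ?W + vec.span {0}" "V + vec.span {w}"]
        dim_plus_line[OF sub(1), of w] w(1) dims(1) by simp
    then have dim0: "vec.dim (V + ?W + vec.span {0}) \<le> k + d" using d by linarith
    obtain f where f: "morphism_of_degree k d f" "f (?p 1 0) = V" "f (?p 0 1) = ?W"
      using curve_through[OF V(1) W a wW w(1) _ dim0] by blast
    have "f (?p 1 0) \<noteq> f (?p 0 1)" using f wW w(1) by blast
    then show thesis
      using that[of f "if v \<in> V then ?p 1 0 else ?p 0 1" "?p 1 0" "?p 1 0"] f True pts nonconst[of f] w wW
      by (cases "v \<in> V") auto
  qed
qed

text \<open>
The span of a stable map gives one inclusion, and the curves of the previous lemma give the other. The
first point of the curve enters only through a vector \<open>v\<close> it shares with \<open>F\<close>, since every value of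
the curve that contains \<open>v\<close> can serve as that point.
\<close>

lemma Gamma_curves_incident:
  fixes F :: "(complex ^ 'n::{finite,linorder}) set"
  assumes k: "1 \<le> k" "k < CARD('n)" and d: "1 \<le> d" and Z: "Z \<subseteq> Gr k"
  shows "Gamma_curves k d {V \<in> Gr k. \<not> V \<inter> F \<subseteq> {0}} Z
    = {V \<in> Gr k. \<exists>V'\<in>Z. \<exists>v\<in>F. v \<noteq> 0 \<and> vec.dim (V + V' + vec.span {v}) \<le> k + d}"
proof (intro subset_antisym subsetI)
  fix V assume "V \<in> Gamma_curves k d {V \<in> Gr k. \<not> V \<inter> F \<subseteq> {0}} Z"
  then obtain M where M: "M \<in> stable_maps k d" "ev 1 M \<in> Gr k" "\<not> ev 1 M \<inter> F \<subseteq> {0}" "ev 2 M \<in> Z"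
    "V = ev 3 M"
    by (auto simp: Gamma_curves_def)
  obtain B where B: "vec.subspace B" "vec.dim B \<le> k + d"
    "\<And>a p. a \<in> comps M \<Longrightarrow> p \<in> P1 \<Longrightarrow> cmap M a p \<subseteq> B"
    using stable_map_span[OF M(1)] by blast
  have marks: "mark M i \<in> comps M \<times> P1" if "i \<in> {1..3}" for i
    using M(1) that unfolding stable_maps_def prestable_curve_def by blast
  have evB: "ev i M \<subseteq> B" if "i \<in> {1..3}" for i
    unfolding ev_def point_val_def using marks[OF that] by (intro B(3)) (auto simp: mem_Times_iff)
  have "V \<in> Gr k"
  proof -
    have "fst (mark M 3) \<in> comps M" "snd (mark M 3) \<in> P1" using marks[of 3] by (auto simp: mem_Times_iff)
    moreover obtain e where "morphism_of_degree k e (cmap M (fst (mark M 3)))"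
      using M(1) calculation(1) unfolding stable_maps_def map_of_degree_def by blast
    ultimately show ?thesis
      unfolding M(5) ev_def point_val_def
      by (auto simp: P1_iff morphism_of_degree_def)
  qed
  moreover obtain v where v: "v \<in> ev 1 M" "v \<in> F" "v \<noteq> 0" using M(3) by blast
  have "V + ev 2 M + vec.span {v} \<subseteq> B"
    using evB[of 1] evB[of 2] evB[of 3] v(1) M(5)
    by (intro subspace_plus_least[OF B(1)] vec.span_minimal[OF _ B(1)]) auto
  then have "vec.dim (V + ev 2 M + vec.span {v}) \<le> k + d" using vec.dim_subset B(2) order.trans by blast
  ultimately show "V \<in> {V \<in> Gr k. \<exists>V'\<in>Z. \<exists>v\<in>F. v \<noteq> 0 \<and> vec.dim (V + V' + vec.span {v}) \<le> k + d}"
    using M(4) v(2,3) by blast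
next
  fix V assume "V \<in> {V \<in> Gr k. \<exists>V'\<in>Z. \<exists>v\<in>F. v \<noteq> 0 \<and> vec.dim (V + V' + vec.span {v}) \<le> k + d}"
  then obtain V' v where V: "V \<in> Gr k" "V' \<in> Z" "v \<in> F" "v \<noteq> 0" "vec.dim (V + V' + vec.span {v}) \<le> k + d"
    by blast
  then have "V' \<in> Gr k" using Z by blast
  then obtain f x1 x2 x3 where f: "morphism_of_degree k d f" "\<not> f constant_on P1"
    "x1 \<in> P1" "x2 \<in> P1" "x3 \<in> P1" "v \<in> f x1" "f x2 = V'" "f x3 = V"
    using curve_incident_to_vector[OF V(1) _ k d V(5)] by blast
  define x where "x = (\<lambda>i::nat. if i = 1 then x1 else if i = 2 then x2 else x3)"
  have "f x1 \<in> Gr k" using f(1,3) by (auto simp: P1_iff morphism_of_degree_def)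
  then have "f (x 3) \<in> Gamma_curves k d {V \<in> Gr k. \<not> V \<inter> F \<subseteq> {0}} Z"
    using f V(2-4) by (intro Gamma_curvesI[OF f(1,2)]) (auto simp: x_def)
  then show "V \<in> Gamma_curves k d {V \<in> Gr k. \<not> V \<inter> F \<subseteq> {0}} Z"
    using f(8) by (simp add: x_def)
qed

section \<open>Subspaces near a Schubert variety\<close>

lemma dim_Int_plus_line:
  fixes V S :: "(complex ^ 'n) set"
  assumes V: "vec.subspace V" and S: "vec.subspace S" and u: "u \<notin> V"
  shows "vec.dim (V \<inter> S) + (if u \<in> S then 1 else 0) \<le> vec.dim ((V + vec.span {u}) \<inter> S)"
proof (cases "u \<in> S")
  case True
  have "vec.subspace (V + vec.span {u})" by (rule subspace_set_plus[OF V vec.subspace_span])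
  then have "(V \<inter> S) + vec.span {u} \<subseteq> (V + vec.span {u}) \<inter> S"
    using subspace_le_plus[OF V vec.subspace_span[of "{u}"]] vec.span_base[of u "{u}"] S True
    by (intro subspace_plus_least vec.span_minimal) (auto simp: vec.subspace_inter)
  from vec.dim_subset[OF this] show ?thesis
    using True u dim_plus_line[of "V \<inter> S" u] V S by (simp add: vec.subspace_inter)
next
  case False
  have "V \<inter> S \<subseteq> (V + vec.span {u}) \<inter> S"
    using subspace_le_plus(1)[OF V vec.subspace_span[of "{u}"]] by blast
  from vec.dim_subset[OF this] show ?thesis using False by simp
qed

text \<open>
Passing from \<open>T\<close> to a hyperplane lowers the dimension of each intersection \<open>T \<inter> S\<close> by at most one,
and not at all for those contained in \<open>D\<close>. This is used with \<open>D\<close> spanned by the intersections whose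
dimension must not drop.
\<close>

lemma hyperplane_section:
  fixes T D :: "(complex ^ 'n) set"
  assumes T: "vec.subspace T" "vec.dim T = k + 1" and D: "vec.subspace D" "D \<subseteq> T" "vec.dim D \<le> k"
  obtains H where "vec.subspace H" "H \<subseteq> T" "vec.dim H = k"
    "\<And>S. T \<inter> S \<subseteq> D \<Longrightarrow> H \<inter> S = T \<inter> S"
    "\<And>S. vec.subspace S \<Longrightarrow> vec.dim (T \<inter> S) \<le> vec.dim (H \<inter> S) + 1"
proof -
  obtain H where H: "vec.subspace H" "D \<subseteq> H" "H \<subseteq> T" "vec.dim H = k"
    using subspace_between[OF D(1) T(1) D(2), of k] D(3) T(2) by auto
  have "vec.dim (T \<inter> S) \<le> vec.dim (H \<inter> S) + 1" if "vec.subspace S" for S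
  proof -
    have "vec.dim H + vec.dim (T \<inter> S) \<le> vec.dim (H \<inter> (T \<inter> S)) + vec.dim T"
      using H(1,3) T(1) that by (intro dim_Int_lower) (auto simp: vec.subspace_inter)
    moreover have "H \<inter> (T \<inter> S) = H \<inter> S" using H(3) by blast
    ultimately show ?thesis using H(4) T(2) by simp
  qed
  moreover have "H \<inter> S = T \<inter> S" if "T \<inter> S \<subseteq> D" for S
    using that H(2,3) by blast
  ultimately show thesis using that H by blast
qed

text \<open>
The conditions are written with \<open>d\<close> on the right, so that those that hold for trivial reasons can be
included. Let \<open>m\<close> be the smallest index at which a condition for \<open>d - 1\<close> fails; since \<open>d \<ge> 2\<close>, this
leaves no room for \<open>P m \<subseteq> V\<close>. Adding a vector of \<open>P m\<close> to \<open>V\<close> repairs all failing conditions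
simultaneously, and gives a space \<open>T\<close> of dimension \<open>k + 1\<close>. Its hyperplane \<open>V'\<close> has to contain the
intersections \<open>T \<inter> P a\<close> and \<open>T \<inter> Q b\<close> of exactly the required dimension, and it suffices to look at
the largest such \<open>a\<close> and \<open>b\<close>. If \<open>a \<le> b\<close> the first of these is contained in the second, of dimension
\<open>b + 2 - d \<le> k\<close>. If \<open>a > b\<close> they share \<open>T \<inter> P b\<close>, of dimension at least \<open>b + 1 - d\<close>, and their sum has
dimension at most \<open>a + 2 - d \<le> k\<close>.
\<close>

lemma near_condition_step:
  fixes P Q :: "nat \<Rightarrow> (complex ^ 'n) set"
  assumes P: "\<And>j. vec.subspace (P j)" "\<And>i j. 1 \<le> i \<Longrightarrow> i \<le> j \<Longrightarrow> j \<le> k \<Longrightarrow> P i \<subseteq> P j"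
      "\<And>j. 1 \<le> j \<Longrightarrow> j \<le> k \<Longrightarrow> j \<le> vec.dim (P j)"
    and Q: "\<And>j. vec.subspace (Q j)" "\<And>i j. 1 \<le> i \<Longrightarrow> i \<le> j \<Longrightarrow> j \<le> k \<Longrightarrow> Q i \<subseteq> Q j"
      "\<And>j. P j \<subseteq> Q j"
    and d: "2 \<le> d" and V: "V \<in> Gr k"
    and cond: "\<And>j. 1 \<le> j \<Longrightarrow> j \<le> k \<Longrightarrow> j \<le> vec.dim (V \<inter> P j) + d"
      "\<And>j. 1 \<le> j \<Longrightarrow> j \<le> k \<Longrightarrow> j + 1 \<le> vec.dim (V \<inter> Q j) + d"
  obtains V' where "V' \<in> Gr k" "vec.dim (V + V') \<le> k + 1"
    "\<And>j. 1 \<le> j \<Longrightarrow> j \<le> k \<Longrightarrow> j + 1 \<le> vec.dim (V' \<inter> P j) + d"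
    "\<And>j. 1 \<le> j \<Longrightarrow> j \<le> k \<Longrightarrow> j + 2 \<le> vec.dim (V' \<inter> Q j) + d"
proof -
  have sub: "vec.subspace V" and dimV: "vec.dim V = k" using V by (auto simp: Gr_def)
  define E where "E = {j \<in> {1..k}. vec.dim (V \<inter> P j) + d \<le> j \<or> vec.dim (V \<inter> Q j) + d \<le> j + 1}"
  show thesis
  proof (cases "E = {}")
    case True
    have "V + V = V" using sub by (simp add: set_plus_eq_span vec.span_eq_iff[THEN iffD2])
    then show thesis
      using that[OF V] True dimV by (force simp: E_def)
  next
    case False
    define m where "m = Min E"
    have finE: "finite E" by (simp add: E_def)
    have mE: "m \<in> E" using Min_in[OF finE False] by (simp add: m_def)
    then have m: "1 \<le> m" "m \<le> k" by (auto simp: E_def)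
    have less: "j \<notin> E" if "j < m" for j using that Min_le[OF finE, of j] by (auto simp: m_def)
    have "\<not> P m \<subseteq> V"
    proof
      assume "P m \<subseteq> V"
      then have "m \<le> vec.dim (V \<inter> P m)" "m \<le> vec.dim (V \<inter> Q m)"
        using P(3)[OF m] vec.dim_subset[of "P m" "V \<inter> P m"] vec.dim_subset[of "P m" "V \<inter> Q m"] Q(3)[of m]
        by auto
      then show False using mE d by (auto simp: E_def)
    qed
    then obtain u where u: "u \<in> P m" "u \<notin> V" by blast
    define T where "T = V + vec.span {u}"
    have T: "vec.subspace T" "vec.dim T = k + 1" "V \<subseteq> T" "u \<in> T"
      using sub dimV u(2) subspace_le_plus[OF sub vec.subspace_span[of "{u}"]] vec.span_base[of u "{u}"]
      by (auto simp: T_def subspace_set_plus dim_plus_line)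
    have gain: "vec.dim (V \<inter> S) + (if u \<in> S then 1 else 0) \<le> vec.dim (T \<inter> S)" if "vec.subspace S" for S
      unfolding T_def by (rule dim_Int_plus_line[OF sub that u(2)])
    have TP: "j + 1 \<le> vec.dim (T \<inter> P j) + d" and TQ: "j + 2 \<le> vec.dim (T \<inter> Q j) + d"
      if j: "1 \<le> j" "j \<le> k" for j
    proof -
      have "u \<in> P j" "u \<in> Q j" if "m \<le> j" using that P(2)[OF m(1) that j(2)] u(1) Q(3)[of j] by auto
      moreover have "j + 1 \<le> vec.dim (V \<inter> P j) + d" "j + 2 \<le> vec.dim (V \<inter> Q j) + d" if "j < m"
        using less[OF that] j by (auto simp: E_def)
      ultimately have "j + 1 \<le> vec.dim (T \<inter> P j) + d \<and> j + 2 \<le> vec.dim (T \<inter> Q j) + d"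
        using cond(1)[OF j] cond(2)[OF j] gain[OF P(1), of j] gain[OF Q(1), of j]
        by (cases "j < m") (simp_all split: if_splits)
      then show "j + 1 \<le> vec.dim (T \<inter> P j) + d" "j + 2 \<le> vec.dim (T \<inter> Q j) + d" by simp_all
    qed
    \<comment> \<open>\<open>A\<close> and \<open>B\<close> are the indices at which \<open>T\<close> has no dimension to spare.\<close>
    define A where "A = {j \<in> {1..k}. vec.dim (T \<inter> P j) + d = j + 1}"
    define B where "B = {j \<in> {1..k}. vec.dim (T \<inter> Q j) + d = j + 2}"
    define DA where "DA = (if A = {} then {0} else T \<inter> P (Max A))"
    define DB where "DB = (if B = {} then {0} else T \<inter> Q (Max B))"
    have fin: "finite A" "finite B" and sub_AB: "A \<subseteq> {1..k}" "B \<subseteq> {1..k}"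
      by (auto simp: A_def B_def)
    have subD: "vec.subspace DA" "vec.subspace DB"
      using T(1) P(1) Q(1) by (auto simp: DA_def DB_def vec.subspace_inter)
    have DT: "DA + DB \<subseteq> T"
      using T(1) by (intro subspace_plus_least) (auto simp: DA_def DB_def vec.subspace_0)
    have inA: "T \<inter> P j \<subseteq> DA + DB" if "j \<in> A" for j
    proof -
      have "j \<le> Max A" "Max A \<in> A" using Max_ge[OF fin(1) that] Max_in[OF fin(1)] that by blast+
      then have "P j \<subseteq> P (Max A)" using that sub_AB by (intro P(2)) auto
      then have "T \<inter> P j \<subseteq> DA" using that by (auto simp: DA_def)
      then show ?thesis using subspace_le_plus(1)[OF subD] by blast
    qed
    have inB: "T \<inter> Q j \<subseteq> DA + DB" if "j \<in> B" for j
    proof -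
      have "j \<le> Max B" "Max B \<in> B" using Max_ge[OF fin(2) that] Max_in[OF fin(2)] that by blast+
      then have "Q j \<subseteq> Q (Max B)" using that sub_AB by (intro Q(2)) auto
      then have "T \<inter> Q j \<subseteq> DB" using that by (auto simp: DB_def)
      then show ?thesis using subspace_le_plus(2)[OF subD] by blast
    qed
    have dimDA: "Max A \<in> {1..k} \<and> vec.dim DA + d = Max A + 1" if "A \<noteq> {}"
    proof -
      have "Max A \<in> A" using Max_in[OF fin(1) that] .
      then show ?thesis using that sub_AB(1) by (auto simp: DA_def) (simp add: A_def)
    qed
    have dimDB: "Max B \<in> {1..k} \<and> vec.dim DB + d = Max B + 2" if "B \<noteq> {}"
    proof -
      have "Max B \<in> B" using Max_in[OF fin(2) that] .
      then show ?thesis using that sub_AB(2) by (auto simp: DB_def) (simp add: B_def)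
    qed
    have "vec.dim (DA + DB) \<le> k"
    proof (cases "A = {} \<or> B = {}")
      case True
      have "vec.dim (DA + DB) \<le> vec.dim DA + vec.dim DB" using dim_plus_Int[OF subD] by linarith
      moreover have "vec.dim DA = 0 \<or> vec.dim DB = 0" using True by (auto simp: DA_def DB_def)
      moreover have "vec.dim DA \<le> k" using dimDA d by (cases "A = {}") (auto simp: DA_def)
      moreover have "vec.dim DB \<le> k" using dimDB d by (cases "B = {}") (auto simp: DB_def)
      ultimately show ?thesis by linarith
    next
      case False
      note DA = dimDA[THEN conjunct1] dimDA[THEN conjunct2] and DB = dimDB[THEN conjunct1] dimDB[THEN conjunct2]
      show ?thesis
      proof (cases "Max A \<le> Max B")
        case True
        have "P (Max A) \<subseteq> Q (Max B)" using P(2)[of "Max A" "Max B"] Q(3)[of "Max B"] DA(1) DB(1) False True by auto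
        then have "DA + DB \<subseteq> DB" using False subD(2) by (intro subspace_plus_least) (auto simp: DA_def DB_def)
        then have "vec.dim (DA + DB) \<le> vec.dim DB" by (rule vec.dim_subset)
        then show ?thesis using DB False d by auto
      next
        case gt: False
        have "P (Max B) \<subseteq> P (Max A)" using P(2)[of "Max B" "Max A"] DA(1) DB(1) False gt by auto
        then have "vec.dim (DA + DB) + vec.dim (T \<inter> P (Max B)) \<le> vec.dim DA + vec.dim DB"
          using False Q(3)[of "Max B"] by (intro dim_plus_common subD) (auto simp: DA_def DB_def)
        then show ?thesis using DA DB False d TP[of "Max B"] by fastforce
      qed
    qed
    then obtain H where H: "vec.subspace H" "H \<subseteq> T" "vec.dim H = k"
      "\<And>S. T \<inter> S \<subseteq> DA + DB \<Longrightarrow> H \<inter> S = T \<inter> S"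
      "\<And>S. vec.subspace S \<Longrightarrow> vec.dim (T \<inter> S) \<le> vec.dim (H \<inter> S) + 1"
      using hyperplane_section[OF T(1,2) subspace_set_plus[OF subD] DT] by blast
    show thesis
    proof (rule that[of H])
      show "H \<in> Gr k" using H by (simp add: Gr_def)
      have "V + H \<subseteq> T" using T H by (intro subspace_plus_least) auto
      then show "vec.dim (V + H) \<le> k + 1" using vec.dim_subset T(2) by metis
    next
      fix j assume j: "1 \<le> j" "j \<le> k"
      show "j + 1 \<le> vec.dim (H \<inter> P j) + d"
        using TP[OF j] H(4)[OF inA, of j] H(5)[OF P(1), of j] j by (cases "j \<in> A") (auto simp: A_def)
      show "j + 2 \<le> vec.dim (H \<inter> Q j) + d"
        using TQ[OF j] H(4)[OF inB, of j] H(5)[OF Q(1), of j] j by (cases "j \<in> B") (auto simp: B_def)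
    qed
  qed
qed

text \<open>
As in the previous lemma, with \<open>m\<close> the smallest index for which \<open>V \<inter> P m\<close> is too small. Now
\<open>V \<inter> (P m + F)\<close> is larger than \<open>V \<inter> P m\<close> and contains a vector \<open>p + v\<close> with \<open>p \<in> P m\<close> and
\<open>0 \<noteq> v \<in> F\<close>. Adding \<open>p\<close> to \<open>V\<close>, or any vector of \<open>P m\<close> outside \<open>V\<close> if \<open>p \<in> V\<close>, gives a space that
contains \<open>v\<close> as well.
\<close>

lemma near_condition_base:
  fixes P :: "nat \<Rightarrow> (complex ^ 'n) set"
  assumes P: "\<And>j. vec.subspace (P j)" "\<And>i j. 1 \<le> i \<Longrightarrow> i \<le> j \<Longrightarrow> j \<le> k \<Longrightarrow> P i \<subseteq> P j"
      "\<And>j. 1 \<le> j \<Longrightarrow> j \<le> k \<Longrightarrow> j \<le> vec.dim (P j)"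
    and F: "vec.subspace F" "F \<noteq> {0}" and V: "V \<in> Gr k"
    and cond: "\<And>j. 1 \<le> j \<Longrightarrow> j \<le> k \<Longrightarrow> j \<le> vec.dim (V \<inter> P j) + 1"
      "\<And>j. 1 \<le> j \<Longrightarrow> j \<le> k \<Longrightarrow> j \<le> vec.dim (V \<inter> (P j + F))"
  obtains V' v where "V' \<in> Gr k" "\<And>j. 1 \<le> j \<Longrightarrow> j \<le> k \<Longrightarrow> j \<le> vec.dim (V' \<inter> P j)"
    "v \<in> F" "v \<noteq> 0" "vec.dim (V + V' + vec.span {v}) \<le> k + 1"
proof -
  have sub: "vec.subspace V" and dimV: "vec.dim V = k" using V by (auto simp: Gr_def)
  define E where "E = {j \<in> {1..k}. vec.dim (V \<inter> P j) < j}"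
  show thesis
  proof (cases "E = {}")
    case True
    obtain v where v: "v \<in> F" "v \<noteq> 0" using F vec.subspace_0 by blast
    have "V + V = V" using sub by (simp add: set_plus_eq_span vec.span_eq_iff[THEN iffD2])
    then have "vec.dim (V + V + vec.span {v}) \<le> k + 1" using dim_plus_line[OF sub, of v] dimV by simp
    moreover have "j \<le> vec.dim (V \<inter> P j)" if "1 \<le> j" "j \<le> k" for j
      using True that by (fastforce simp: E_def)
    ultimately show thesis using that[OF V] v by blast
  next
    case False
    define m where "m = Min E"
    have finE: "finite E" by (simp add: E_def)
    have mE: "m \<in> E" using Min_in[OF finE False] by (simp add: m_def)
    then have m: "1 \<le> m" "m \<le> k" "vec.dim (V \<inter> P m) < m" by (auto simp: E_def)
    have less: "j \<notin> E" if "j < m" for j using that Min_le[OF finE, of j] by (auto simp: m_def)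
    have "\<not> V \<inter> (P m + F) \<subseteq> V \<inter> P m"
      using vec.dim_subset[of "V \<inter> (P m + F)" "V \<inter> P m"] cond(2)[OF m(1,2)] m(3) by linarith
    then obtain w where w: "w \<in> V" "w \<in> P m + F" "w \<notin> P m" by blast
    then obtain p v where v: "w = p + v" "p \<in> P m" "v \<in> F" by (auto simp: set_plus_def)
    have v0: "v \<noteq> 0" using v w(3) by auto
    have "\<not> P m \<subseteq> V"
    proof
      assume "P m \<subseteq> V"
      then have "V \<inter> P m = P m" by blast
      then show False using P(3)[OF m(1,2)] m(3) by simp
    qed
    then obtain u where u: "u \<in> P m" "u \<notin> V" "p \<notin> V \<Longrightarrow> u = p"
      using v(2) by (cases "p \<in> V") auto
    define T where "T = V + vec.span {u}"
    have T: "vec.subspace T" "vec.dim T = k + 1" "V \<subseteq> T" "u \<in> T"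
      using sub dimV u(2) subspace_le_plus[OF sub vec.subspace_span[of "{u}"]] vec.span_base[of u "{u}"]
      by (auto simp: T_def subspace_set_plus dim_plus_line)
    have "p \<in> T" using T(3,4) u(3) by (cases "p \<in> V") auto
    then have vT: "v \<in> T"
      using vec.subspace_diff[OF T(1), of w p] T(3) w(1) v(1) by auto
    have TP: "j \<le> vec.dim (T \<inter> P j)" if j: "1 \<le> j" "j \<le> k" for j
    proof (cases "j < m")
      case True
      then have "j \<le> vec.dim (V \<inter> P j)" using less[OF True] j by (auto simp: E_def)
      then show ?thesis
        using dim_Int_plus_line[OF sub P(1) u(2), of j] by (simp add: T_def)
    next
      case False
      then have "u \<in> P j" using P(2)[OF m(1) _ j(2)] u(1) by auto
      then show ?thesis
        using dim_Int_plus_line[OF sub P(1) u(2), of j] cond(1)[OF j] by (simp add: T_def)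
    qed
    define A where "A = {j \<in> {1..k}. vec.dim (T \<inter> P j) = j}"
    define D where "D = (if A = {} then {0} else T \<inter> P (Max A))"
    have fin: "finite A" and sub_A: "A \<subseteq> {1..k}" by (auto simp: A_def)
    have D: "vec.subspace D" "D \<subseteq> T"
      using T(1) P(1) by (auto simp: D_def vec.subspace_inter vec.subspace_0)
    have "vec.dim D \<le> k"
    proof (cases "A = {}")
      case False
      then have "Max A \<in> A" by (rule Max_in[OF fin])
      then have "vec.dim (T \<inter> P (Max A)) = Max A" "Max A \<in> {1..k}" by (simp_all add: A_def)
      then show ?thesis using False by (simp add: D_def)
    qed (simp add: D_def)
    then obtain H where H: "vec.subspace H" "H \<subseteq> T" "vec.dim H = k"
      "\<And>S. T \<inter> S \<subseteq> D \<Longrightarrow> H \<inter> S = T \<inter> S"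
      "\<And>S. vec.subspace S \<Longrightarrow> vec.dim (T \<inter> S) \<le> vec.dim (H \<inter> S) + 1"
      using hyperplane_section[OF T(1,2) D] by blast
    have "j \<le> vec.dim (H \<inter> P j)" if j: "1 \<le> j" "j \<le> k" for j
    proof (cases "j \<in> A")
      case True
      have "j \<le> Max A" "Max A \<in> A" using Max_ge[OF fin True] Max_in[OF fin] True by blast+
      then have "P j \<subseteq> P (Max A)" using True sub_A by (intro P(2)) auto
      then have "T \<inter> P j \<subseteq> D" using True by (auto simp: D_def)
      from H(4)[OF this] show ?thesis using TP[OF j] by simp
    next
      case False
      then show ?thesis using TP[OF j] H(5)[OF P(1), of j] j by (auto simp: A_def)
    qed
    moreover have "H \<in> Gr k" using H by (simp add: Gr_def)
    moreover have "V + H + vec.span {v} \<subseteq> T"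
      using T H(2) vT by (intro subspace_plus_least vec.span_minimal) auto
    then have "vec.dim (V + H + vec.span {v}) \<le> k + 1" using vec.dim_subset T(2) by metis
    ultimately show thesis using that v(3) v0 by blast
  qed
qed

text \<open>
Each step of the induction enlarges the span by at most one dimension, because \<open>V + V'\<close> and
\<open>V' + W + \<langle>v\<rangle>\<close> share the \<open>k\<close>-dimensional space \<open>V'\<close>.
\<close>

lemma near_condition_imp_incident:
  fixes P :: "nat \<Rightarrow> (complex ^ 'n) set"
  assumes P: "\<And>j. vec.subspace (P j)" "\<And>i j. 1 \<le> i \<Longrightarrow> i \<le> j \<Longrightarrow> j \<le> k \<Longrightarrow> P i \<subseteq> P j"
      "\<And>j. 1 \<le> j \<Longrightarrow> j \<le> k \<Longrightarrow> j \<le> vec.dim (P j)"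
    and F: "vec.subspace F" "F \<noteq> {0}" and d: "1 \<le> d" and V: "V \<in> Gr k"
    and cond: "\<And>j. 1 \<le> j \<Longrightarrow> j \<le> k \<Longrightarrow> j \<le> vec.dim (V \<inter> P j) + d"
      "\<And>j. 1 \<le> j \<Longrightarrow> j \<le> k \<Longrightarrow> j + 1 \<le> vec.dim (V \<inter> (P j + F)) + d"
  shows "\<exists>V'\<in>Gr k. (\<forall>j\<in>{1..k}. j \<le> vec.dim (V' \<inter> P j)) \<and>
    (\<exists>v\<in>F. v \<noteq> 0 \<and> vec.dim (V + V' + vec.span {v}) \<le> k + d)"
  using d V cond
proof (induction d arbitrary: V rule: dec_induct)
  case base
  obtain V' v where "V' \<in> Gr k" "\<And>j. 1 \<le> j \<Longrightarrow> j \<le> k \<Longrightarrow> j \<le> vec.dim (V' \<inter> P j)"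
    "v \<in> F" "v \<noteq> 0" "vec.dim (V + V' + vec.span {v}) \<le> k + 1"
    by (rule near_condition_base[of P k F V]) (use P F base in auto)
  then show ?case by (intro bexI[of _ V'] conjI ballI bexI[of _ v]) auto
next
  case (step d)
  have Q: "vec.subspace (P j + F)" "P j \<subseteq> P j + F" for j
    by (simp_all add: P(1) F(1) subspace_set_plus subspace_le_plus)
  have Qmono: "P i + F \<subseteq> P j + F" if "1 \<le> i" "i \<le> j" "j \<le> k" for i j
    using P(2)[OF that] by (intro set_plus_mono2) auto
  obtain V' where V': "V' \<in> Gr k" "vec.dim (V + V') \<le> k + 1"
    "\<And>j. 1 \<le> j \<Longrightarrow> j \<le> k \<Longrightarrow> j + 1 \<le> vec.dim (V' \<inter> P j) + Suc d"
    "\<And>j. 1 \<le> j \<Longrightarrow> j \<le> k \<Longrightarrow> j + 2 \<le> vec.dim (V' \<inter> (P j + F)) + Suc d"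
    by (rule near_condition_step[of P k "\<lambda>j. P j + F" "Suc d" V])
       (use P Q Qmono step in auto)
  have "\<exists>W\<in>Gr k. (\<forall>j\<in>{1..k}. j \<le> vec.dim (W \<inter> P j)) \<and>
    (\<exists>v\<in>F. v \<noteq> 0 \<and> vec.dim (V' + W + vec.span {v}) \<le> k + d)"
    using step.IH[OF V'(1)] V'(3,4) by force
  then obtain W v where W: "W \<in> Gr k" "\<forall>j\<in>{1..k}. j \<le> vec.dim (W \<inter> P j)" "v \<in> F" "v \<noteq> 0"
    "vec.dim (V' + W + vec.span {v}) \<le> k + d" by blast
  have sub: "vec.subspace V" "vec.subspace V'" "vec.subspace W" and dimV': "vec.dim V' = k"
    using step.prems(1) V'(1) W(1) by (auto simp: Gr_def)
  let ?A = "V + V'" and ?B = "V' + W + vec.span {v}"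
  have subAB: "vec.subspace ?A" "vec.subspace (V' + W)" "vec.subspace ?B"
    using sub by (auto simp: subspace_set_plus)
  have le: "V \<subseteq> ?A" "V' \<subseteq> ?A" "V' \<subseteq> V' + W" "W \<subseteq> V' + W" "V' + W \<subseteq> ?B" "vec.span {v} \<subseteq> ?B"
    "?A \<subseteq> ?A + ?B" "?B \<subseteq> ?A + ?B"
    using sub subAB by (simp_all add: subspace_le_plus)
  have "vec.dim (?A + ?B) + k \<le> vec.dim ?A + vec.dim ?B"
    using dim_plus_common[OF subAB(1,3), of V'] le dimV' by auto
  moreover have "vec.subspace (?A + ?B)" by (rule subspace_set_plus[OF subAB(1,3)])
  then have "V + W + vec.span {v} \<subseteq> ?A + ?B"
    using le by (intro subspace_plus_least) blast+
  ultimately have "vec.dim (V + W + vec.span {v}) \<le> k + Suc d"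
    using vec.dim_subset[of "V + W + vec.span {v}" "?A + ?B"] V'(2) W(5) by linarith
  then show ?case using W by blast
qed

text \<open>
Inside a space of dimension at most \<open>k + d\<close>, the \<open>k\<close>-dimensional \<open>V\<close> meets \<open>V' \<inter> P j\<close> in dimension at
least \<open>j - d\<close>, and \<open>(V' \<inter> P j) + \<langle>v\<rangle>\<close> in one more dimension unless \<open>v \<in> P j\<close>. In the latter case
transversality gives \<open>P j + F = UNIV\<close>, and the second bound is trivial.
\<close>

lemma incident_imp_near_condition:
  fixes P :: "nat \<Rightarrow> (complex ^ 'n) set"
  assumes P: "vec.subspace (P j)" and F: "vec.subspace F"
    and transversal: "P j \<inter> F \<subseteq> {0} \<or> P j + F = UNIV"
    and d: "1 \<le> d" and V: "V \<in> Gr k" "V' \<in> Gr k" and j: "j \<le> k" "j \<le> vec.dim (V' \<inter> P j)"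
    and v: "v \<in> F" "v \<noteq> 0" and dim: "vec.dim (V + V' + vec.span {v}) \<le> k + d"
  shows "j \<le> vec.dim (V \<inter> P j) + d" "j + 1 \<le> vec.dim (V \<inter> (P j + F)) + d"
proof -
  let ?B = "V + V' + vec.span {v}" and ?W = "V' \<inter> P j"
  have sub: "vec.subspace V" "vec.subspace V'" "vec.subspace (V + V')" "vec.subspace ?B" "vec.subspace ?W"
    "vec.subspace (P j + F)" and dimV: "vec.dim V = k"
    using V P F by (auto simp: Gr_def subspace_set_plus vec.subspace_inter)
  have le: "V \<subseteq> V + V'" "V' \<subseteq> V + V'" "V + V' \<subseteq> ?B" "vec.span {v} \<subseteq> ?B" "P j \<subseteq> P j + F" "F \<subseteq> P j + F"
    using sub P F by (simp_all add: subspace_le_plus)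
  have "k + vec.dim ?W \<le> vec.dim (V \<inter> ?W) + vec.dim ?B"
    using dim_Int_lower[OF sub(1,5,4)] le dimV by auto
  moreover have "vec.dim (V \<inter> ?W) \<le> vec.dim (V \<inter> P j)" by (intro vec.dim_subset) auto
  ultimately show "j \<le> vec.dim (V \<inter> P j) + d" using j(2) dim by linarith
  show "j + 1 \<le> vec.dim (V \<inter> (P j + F)) + d"
  proof (cases "P j + F = UNIV")
    case True
    then show ?thesis using dimV j(1) d by simp
  next
    case False
    then have "v \<notin> ?W" using transversal v by auto
    let ?W' = "?W + vec.span {v}"
    have dimW': "vec.dim ?W' = vec.dim ?W + 1"
      using \<open>v \<notin> ?W\<close> by (simp add: dim_plus_line[OF sub(5)])
    have W': "vec.subspace ?W'" by (simp add: subspace_set_plus sub)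
    have W'B: "?W' \<subseteq> ?B" using le by (intro subspace_plus_least[OF sub(4)]) blast+
    have "vec.span {v} \<subseteq> P j + F" using v(1) le(6) by (intro vec.span_minimal[OF _ sub(6)]) auto
    then have W'Q: "?W' \<subseteq> P j + F" using le by (intro subspace_plus_least[OF sub(6)]) blast+
    have "k + vec.dim ?W' \<le> vec.dim (V \<inter> ?W') + vec.dim ?B"
      using dim_Int_lower[OF sub(1) W' sub(4)] W'B le dimV by auto
    moreover have "vec.dim (V \<inter> ?W') \<le> vec.dim (V \<inter> (P j + F))"
      using W'Q by (intro vec.dim_subset) auto
    ultimately show ?thesis using dimW' j(2) dim by linarith
  qed
qed

section \<open>Coordinate flags\<close>

lemma bij_betw_idx: "bij_betw (idx :: nat \<Rightarrow> 'n::{finite,linorder}) {1..CARD('n)} UNIV"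
proof -
  let ?l = "sorted_list_of_set (UNIV :: 'n set)"
  have "bij_betw ((!) ?l) {..<CARD('n)} UNIV"
    by (rule bij_betw_nth) auto
  moreover have "bij_betw (\<lambda>j. j - 1) {1..CARD('n)} {..<CARD('n)}"
    by (rule bij_betwI[where g = Suc]) auto
  ultimately have "bij_betw ((!) ?l \<circ> (\<lambda>j. j - 1)) {1..CARD('n)} UNIV" by (rule bij_betw_trans[rotated])
  moreover have "(!) ?l \<circ> (\<lambda>j. j - 1) = idx" by (rule ext) (simp add: idx_def)
  ultimately show ?thesis by (simp only:)
qed

lemma inj_on_e_vec: "inj_on (e_vec :: nat \<Rightarrow> complex ^ 'n::{finite,linorder}) {1..CARD('n)}"
proof (rule inj_onI)
  fix i j assume ij: "i \<in> {1..CARD('n)}" "j \<in> {1..CARD('n)}" "e_vec i = (e_vec j :: (complex, 'n) vec)"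
  then have "idx i = (idx j :: 'n)" by (simp add: e_vec_def axis_eq_axis)
  then show "i = j" using inj_onD[OF bij_betw_imp_inj_on[OF bij_betw_idx[where 'n = 'n]]] ij(1,2) by blast
qed

lemma independent_e_vec: "vec.independent ((e_vec :: nat \<Rightarrow> complex ^ 'n::{finite,linorder}) ` I)"
  by (rule vec.independent_mono[OF vec.independent_Basis]) (auto simp: e_vec_def cart_basis_def)

lemma dim_span_e_vec:
  assumes "I \<subseteq> {1..CARD('n)}"
  shows "vec.dim (vec.span ((e_vec :: nat \<Rightarrow> complex ^ 'n::{finite,linorder}) ` I)) = card I"
  unfolding vec.dim_span_eq_card_independent[OF independent_e_vec]
  by (rule card_image[OF inj_on_subset[OF inj_on_e_vec assms]])

lemma subspace_flags [simp]:
  "vec.subspace (F_std j)" "vec.subspace (F_opp j)" "vec.subspace (F_tilde j)"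
  by (simp_all add: F_std_def F_opp_def F_tilde_def)

lemma F_opp_mono: "i \<le> j \<Longrightarrow> F_opp i \<subseteq> F_opp j"
  unfolding F_opp_def by (intro vec.span_mono image_mono) auto

lemma dim_F_opp:
  assumes "j \<le> CARD('n)"
  shows "vec.dim (F_opp j :: (complex ^ 'n::{finite,linorder}) set) = j"
  unfolding F_opp_def using assms by (subst dim_span_e_vec) auto

lemma dim_F_std:
  assumes "j \<le> CARD('n)"
  shows "vec.dim (F_std j :: (complex ^ 'n::{finite,linorder}) set) = j"
  unfolding F_std_def using assms by (subst dim_span_e_vec) auto

lemma F_opp_plus_F_std:
  "F_opp i + F_std j
    = vec.span ((e_vec :: nat \<Rightarrow> complex ^ 'n::{finite,linorder}) ` ({CARD('n) - i + 1..CARD('n)} \<union> {1..j}))"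
  by (auto simp: F_opp_def F_std_def image_Un vec.span_Un set_plus_def)

lemma F_opp_transversal:
  fixes i j :: nat
  assumes "i \<le> CARD('n)" "j \<le> CARD('n)"
  shows "F_opp i \<inter> F_std j \<subseteq> {0 :: complex ^ 'n::{finite,linorder}} \<or>
    F_opp i + F_std j = (UNIV :: (complex ^ 'n::{finite,linorder}) set)"
proof (cases "i + j \<le> CARD('n)")
  case True
  have "card ({CARD('n) - i + 1..CARD('n)} \<union> {1..j}) = i + j"
    using True assms by (subst card_Un_disjoint) auto
  then have "vec.dim (F_opp i + F_std j :: (complex, 'n) vec set) = i + j"
    unfolding F_opp_plus_F_std using assms by (subst dim_span_e_vec) auto
  then have "vec.dim (F_opp i \<inter> F_std j :: (complex, 'n) vec set) = 0"
    using dim_plus_Int[of "F_opp i :: (complex, 'n) vec set" "F_std j"] dim_F_opp[OF assms(1)] dim_F_std[OF assms(2)]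
    by simp
  then show ?thesis by (simp add: vec.dim_eq_0)
next
  case False
  have "{CARD('n) - i + 1..CARD('n)} \<union> {1..j} = {1..CARD('n)}" using False assms by auto
  then have "vec.dim (F_opp i + F_std j :: (complex, 'n) vec set) = CARD('n)"
    unfolding F_opp_plus_F_std by (subst dim_span_e_vec) auto
  then have "F_opp i + F_std j = (UNIV :: (complex, 'n) vec set)"
    by (intro subspace_eqI) (auto simp: subspace_set_plus vec_dim_card simp del: vec.dim_UNIV)
  then show ?thesis by blast
qed

text \<open>
The conditions with index \<open>j \<ge> 2\<close> in the definition hold for every \<open>V\<close> by a dimension count.
\<close>

lemma X_special_eq:
  assumes "1 \<le> k" "k \<le> CARD('n)"
  shows "X_special k i = {V \<in> Gr k. \<not> V \<inter> F_std (CARD('n) - k + 1 - i) \<subseteq> {0 :: complex ^ 'n::{finite,linorder}}}"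
proof -
  have triv: "j \<le> vec.dim (V \<inter> F_std (CARD('n) - k + j))"
    if V: "V \<in> Gr k" and j: "j \<le> k" for V :: "(complex, 'n) vec set" and j
    using dim_Int_lower[of V "F_std (CARD('n) - k + j)" UNIV] V j assms
      dim_F_std[of "CARD('n) - k + j", where 'n = 'n]
    by (simp add: Gr_def vec_dim_card del: vec.dim_UNIV)
  have one: "1 \<le> vec.dim S \<longleftrightarrow> \<not> S \<subseteq> {0}" for S :: "(complex, 'n) vec set"
    using vec.dim_eq_0[of S] by linarith
  show ?thesis
  proof (intro subset_antisym subsetI)
    fix V :: "(complex, 'n) vec set" assume "V \<in> X_special k i"
    then have "V \<in> Gr k" "1 \<le> vec.dim (V \<inter> F_std (CARD('n) - k + 1 - i))"
      using assms(1) by (force simp: X_special_def X_up_def)+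
    then show "V \<in> {V \<in> Gr k. \<not> V \<inter> F_std (CARD('n) - k + 1 - i) \<subseteq> {0}}" unfolding one by simp
  next
    fix V :: "(complex, 'n) vec set" assume "V \<in> {V \<in> Gr k. \<not> V \<inter> F_std (CARD('n) - k + 1 - i) \<subseteq> {0}}"
    then have "V \<in> Gr k" "1 \<le> vec.dim (V \<inter> F_std (CARD('n) - k + 1 - i))" unfolding one by simp_all
    then show "V \<in> X_special k i"
      unfolding X_special_def X_up_def using triv[of V] by (auto simp del: One_nat_def)
  qed
qed

lemma partition_antitone:
  assumes "lam \<in> partitions_in k n" "1 \<le> i" "i \<le> j" "j \<le> k"
  shows "lam j \<le> lam i"
  using assms(3,4)
proof (induction j rule: dec_induct)
  case (step j)
  then have "lam (j + 1) \<le> lam j" using assms(1,2) by (auto simp: partitions_in_def)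
  then show ?case using step by simp
qed simp

section \<open>Curve neighborhoods of Schubert varieties\<close>

lemma Gamma_curves_special:
  fixes k n d i :: nat and \<eta> :: "nat \<Rightarrow> nat"
  assumes n: "n = CARD('n::{finite,linorder})" and k: "1 \<le> k" "k < n" and \<eta>: "\<eta> \<in> partitions_in k n"
    and i: "1 \<le> i" "i \<le> n - k" and d: "1 \<le> d"
  shows "Gamma_curves k d (X_special k i) (X_low k \<eta>) =
      {V \<in> Gr k :: (complex ^ ('n::{finite,linorder})) set set.
        (\<forall>j\<in>{1..k}. j \<le> vec.dim (V \<inter> F_opp (j + \<eta> (k - j + 1))) + d) \<and>
        (\<forall>j\<in>{1..k}. j + 1 \<le> vec.dim (V \<inter> (F_opp (j + \<eta> (k - j + 1)) + F_std (n - k + 1 - i))) + d)}"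
proof -
  define P where "P = (\<lambda>j. F_opp (j + \<eta> (k - j + 1)) :: (complex, 'n) vec set)"
  define F where "F = (F_std (n - k + 1 - i) :: (complex, 'n) vec set)"
  have m_le: "j + \<eta> (k - j + 1) \<le> n" if "1 \<le> j" "j \<le> k" for j
  proof -
    have "\<eta> (k - j + 1) \<le> n - k" using \<eta> that by (auto simp: partitions_in_def)
    then show ?thesis using that k by linarith
  qed
  have P: "vec.subspace (P j)" for j by (simp add: P_def)
  have Pmono: "P a \<subseteq> P b" if "1 \<le> a" "a \<le> b" "b \<le> k" for a b
  proof -
    have "\<eta> (k - a + 1) \<le> \<eta> (k - b + 1)"
      by (rule partition_antitone[OF \<eta>]) (use that in arith)+
    then show ?thesis unfolding P_def using that by (intro F_opp_mono) linarith
  qed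
  have Pdim: "j \<le> vec.dim (P j)" if "1 \<le> j" "j \<le> k" for j
    unfolding P_def using m_le[OF that] n by (subst dim_F_opp) auto
  have F: "vec.subspace F" by (simp add: F_def)
  have "vec.dim F = n - k + 1 - i" unfolding F_def using k i n by (subst dim_F_std) auto
  then have F0: "F \<noteq> {0}" using i by auto
  have tr: "P j \<inter> F \<subseteq> {0} \<or> P j + F = UNIV" if "1 \<le> j" "j \<le> k" for j
    unfolding P_def F_def using m_le[OF that] n k i by (intro F_opp_transversal) auto
  have Xl: "X_low k \<eta> = {V \<in> Gr k. \<forall>j\<in>{1..k}. j \<le> vec.dim (V \<inter> P j)}"
    unfolding X_low_def X_flag_def P_def by (intro Collect_cong conj_cong refl ball_cong) (simp add: Suc_diff_le)
  have "Gamma_curves k d (X_special k i) (X_low k \<eta>)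
    = {V \<in> Gr k. \<exists>V'\<in>X_low k \<eta>. \<exists>v\<in>F. v \<noteq> 0 \<and> vec.dim (V + V' + vec.span {v}) \<le> k + d}"
    unfolding X_special_eq[OF k(1) less_imp_le[OF k(2)[unfolded n]], folded n] F_def[symmetric]
    by (rule Gamma_curves_incident) (use k d n Xl in auto)
  also have "\<dots> = {V \<in> Gr k. (\<forall>j\<in>{1..k}. j \<le> vec.dim (V \<inter> P j) + d) \<and>
        (\<forall>j\<in>{1..k}. j + 1 \<le> vec.dim (V \<inter> (P j + F)) + d)}"
  proof (intro Collect_cong conj_cong refl iffI)
    fix V :: "(complex, 'n) vec set" assume V: "V \<in> Gr k"
    {
      assume "\<exists>V'\<in>X_low k \<eta>. \<exists>v\<in>F. v \<noteq> 0 \<and> vec.dim (V + V' + vec.span {v}) \<le> k + d"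
      then obtain V' v where V': "V' \<in> Gr k" "\<forall>j\<in>{1..k}. j \<le> vec.dim (V' \<inter> P j)" "v \<in> F" "v \<noteq> 0"
        "vec.dim (V + V' + vec.span {v}) \<le> k + d" by (auto simp: Xl)
      have "j \<le> vec.dim (V \<inter> P j) + d" "j + 1 \<le> vec.dim (V \<inter> (P j + F)) + d" if "j \<in> {1..k}" for j
        using incident_imp_near_condition[of P j F d V k V' v] P F tr[of j] d V V' that by auto
      then show "(\<forall>j\<in>{1..k}. j \<le> vec.dim (V \<inter> P j) + d) \<and>
        (\<forall>j\<in>{1..k}. j + 1 \<le> vec.dim (V \<inter> (P j + F)) + d)" by blast
    next
      assume c: "(\<forall>j\<in>{1..k}. j \<le> vec.dim (V \<inter> P j) + d) \<and>
        (\<forall>j\<in>{1..k}. j + 1 \<le> vec.dim (V \<inter> (P j + F)) + d)"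
      have "\<exists>V'\<in>Gr k. (\<forall>j\<in>{1..k}. j \<le> vec.dim (V' \<inter> P j)) \<and>
          (\<exists>v\<in>F. v \<noteq> 0 \<and> vec.dim (V + V' + vec.span {v}) \<le> k + d)"
        by (rule near_condition_imp_incident[OF P Pmono Pdim F F0 d V]) (use c in auto)
      then show "\<exists>V'\<in>X_low k \<eta>. \<exists>v\<in>F. v \<noteq> 0 \<and> vec.dim (V + V' + vec.span {v}) \<le> k + d"
        unfolding Xl by blast
    }
  qed
  finally show ?thesis by (simp add: P_def F_def)
qed

section \<open>The shifted flag\<close>

lemma F_tilde_Suc:
  assumes "j \<le> CARD('n)"
  shows "F_tilde (j + 1) = F_opp j + (F_std 1 :: (complex ^ 'n::{finite,linorder}) set)"
proof -
  have "CARD('n) + 2 - (j + 1) = CARD('n) - j + 1" using assms by simp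
  then show ?thesis by (simp add: F_tilde_def F_opp_plus_F_std)
qed

lemma F_tilde_mono: "i \<le> j \<Longrightarrow> F_tilde i \<subseteq> (F_tilde j :: (complex ^ 'n::{finite,linorder}) set)"
proof (cases "i = 0")
  case True
  then have "F_tilde i = {0 :: (complex, 'n) vec}" by (simp add: F_tilde_def)
  then show "F_tilde i \<subseteq> (F_tilde j :: (complex, 'n) vec set)"
    using vec.subspace_0[OF subspace_flags(3)] by simp
next
  case False
  assume "i \<le> j"
  then have "insert (e_vec 1) (e_vec ` {CARD('n) + 2 - i..CARD('n)})
      \<subseteq> (insert (e_vec 1) (e_vec ` {CARD('n) + 2 - j..CARD('n)}) :: (complex, 'n) vec set)"
    by (intro insert_mono image_mono) auto
  from vec.span_mono[OF this] show "F_tilde i \<subseteq> (F_tilde j :: (complex, 'n) vec set)"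
    using False \<open>i \<le> j\<close> by (simp add: F_tilde_def)
qed

lemma dim_F_tilde:
  assumes "j \<le> CARD('n)"
  shows "vec.dim (F_tilde j :: (complex ^ 'n::{finite,linorder}) set) = j"
proof (cases "j = 0")
  case False
  have "F_tilde j = vec.span ((e_vec :: nat \<Rightarrow> (complex, 'n) vec) ` insert 1 {CARD('n) + 2 - j..CARD('n)})"
    using False by (simp add: F_tilde_def)
  then show ?thesis using False assms by (simp only:) (subst dim_span_e_vec, auto)
qed (simp add: F_tilde_def)

lemma complete_flag_F_tilde: "complete_flag (F_tilde :: nat \<Rightarrow> (complex ^ 'n::{finite,linorder}) set)"
  by (simp add: complete_flag_def dim_F_tilde F_tilde_mono)

lemma cyc_e_vec:
  assumes "j \<in> {1..CARD('n)}"
  shows "cyc *v e_vec j = (e_vec (if j = CARD('n) then 1 else j + 1) :: complex ^ 'n::{finite,linorder})"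
proof -
  have inj: "inj_on (idx :: nat \<Rightarrow> 'n) {1..CARD('n)}"
    by (rule bij_betw_imp_inj_on[OF bij_betw_idx])
  have "(cyc *v e_vec j) $ a = (cyc :: ((complex, 'n) vec, 'n) vec) $ a $ idx j" for a
    by (simp add: matrix_vector_mult_def e_vec_def axis_def if_distrib[of "\<lambda>x. _ * x"] cong: if_cong)
  also have "\<dots> a = (e_vec (if j = CARD('n) then 1 else j + 1) :: (complex, 'n) vec) $ a" for a
  proof -
    have "(\<exists>i\<in>{1..<CARD('n)}. a = idx (i + 1) \<and> idx j = (idx i :: 'n)) \<longleftrightarrow> j \<noteq> CARD('n) \<and> a = idx (j + 1)"
      using assms inj_onD[OF inj, of j] by fastforce
    moreover have "idx j = (idx CARD('n) :: 'n) \<longleftrightarrow> j = CARD('n)"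
      using inj_onD[OF inj, of j "CARD('n)"] assms by auto
    ultimately have "(\<exists>i\<in>{1..<CARD('n)}. a = idx (i + 1) \<and> idx j = (idx i :: 'n)) \<or> (a = idx 1 \<and> idx j = (idx CARD('n) :: 'n))
        \<longleftrightarrow> a = idx (if j = CARD('n) then 1 else j + 1)"
      by (cases "j = CARD('n)") auto
    then show ?thesis
      by (simp only: cyc_def vec_lambda_beta e_vec_def axis_def)
  qed
  finally show ?thesis by (simp add: vec_eq_iff)
qed

lemma cyc_F_opp:
  assumes "j \<le> CARD('n)"
  shows "(*v) cyc ` F_opp j = (F_tilde j :: (complex ^ 'n::{finite,linorder}) set)"
proof (cases "j = 0")
  case True
  then show ?thesis by (simp add: F_opp_def F_tilde_def)
next
  case False
  have "(*v) cyc ` F_opp j = vec.span ((\<lambda>i. cyc *v e_vec i) ` {CARD('n) - j + 1..CARD('n)} :: (complex, 'n) vec set)"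
    unfolding F_opp_def vec.linear_span_image[OF matrix_vector_mul_linear_gen, symmetric] image_image ..
  also have "(\<lambda>i. cyc *v e_vec i) ` {CARD('n) - j + 1..CARD('n)}
     = (insert (e_vec 1) (e_vec ` {CARD('n) + 2 - j..CARD('n)}) :: (complex, 'n) vec set)"
  proof -
    have "{CARD('n) - j + 1..CARD('n)} = insert CARD('n) {CARD('n) - j + 1..<CARD('n)}"
      using False assms by auto
    moreover have "(\<lambda>i. cyc *v e_vec i) ` {CARD('n) - j + 1..<CARD('n)}
        = (e_vec ` Suc ` {CARD('n) - j + 1..<CARD('n)} :: (complex, 'n) vec set)"
      unfolding image_image by (intro image_cong refl) (subst cyc_e_vec, auto)
    moreover have "Suc ` {CARD('n) - j + 1..<CARD('n)} = {CARD('n) + 2 - j..CARD('n)}"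
      using assms by (simp add: image_Suc_atLeastLessThan atLeastLessThanSuc_atLeastAtMost Suc_diff_le)
    moreover have "cyc *v e_vec CARD('n) = (e_vec 1 :: (complex, 'n) vec)"
      by (subst cyc_e_vec) (auto simp: Suc_le_eq)
    ultimately show ?thesis by (simp only: image_insert)
  qed
  finally show ?thesis using False by (simp add: F_tilde_def)
qed

lemma bij_cyc: "bij ((*v) (cyc :: complex ^ 'n::{finite,linorder} ^ 'n::{finite,linorder}))"
proof -
  let ?A = "(*v) (cyc :: ((complex, 'n) vec, 'n) vec)"
  have lin: "Vector_Spaces.linear (*s) (*s) ?A" by simp
  have "F_opp CARD('n) = (UNIV :: (complex, 'n) vec set)"
    by (intro subspace_eqI) (auto simp: dim_F_opp vec_dim_card simp del: vec.dim_UNIV)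
  moreover have "F_tilde CARD('n) = (UNIV :: (complex, 'n) vec set)"
    by (intro subspace_eqI) (auto simp: dim_F_tilde vec_dim_card simp del: vec.dim_UNIV)
  ultimately have surj: "surj ?A" using cyc_F_opp[where 'n = 'n, OF order.refl] by simp
  then show ?thesis using vec.linear_surj_imp_inj[OF lin] by (simp add: bij_def)
qed

lemma dim_bij_image:
  fixes A :: "complex ^ 'n ^ 'n"
  assumes "bij ((*v) A)"
  shows "vec.dim ((*v) A ` S) = vec.dim S"
  using assms by (intro vec.dim_image_eq) (auto simp: bij_def intro: inj_on_subset)

lemma X_flag_translate:
  fixes A :: "complex ^ 'n ^ 'n"
  assumes A: "bij ((*v) A)" and G: "\<And>j. j \<in> {1..k} \<Longrightarrow> G' (j + lam (k + 1 - j)) = (*v) A ` G (j + lam (k + 1 - j))"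
  shows "X_flag k lam G' = translate A (X_flag k lam G)"
proof (intro subset_antisym subsetI)
  have inter: "(*v) A ` U \<inter> (*v) A ` W = (*v) A ` (U \<inter> W)" for U W
    using A by (intro image_Int[symmetric]) (simp add: bij_def)
  {
    fix V assume "V \<in> translate A (X_flag k lam G)"
    then obtain U where U: "V = (*v) A ` U" "U \<in> X_flag k lam G" by (auto simp: translate_def)
    then show "V \<in> X_flag k lam G'"
      using dim_bij_image[OF A] G vec.linear_subspace_image[OF matrix_vector_mul_linear_gen, of U A]
      by (simp add: X_flag_def Gr_def inter)
  next
    fix V assume V: "V \<in> X_flag k lam G'"
    define U where "U = (*v) A -` V"
    have AU: "(*v) A ` U = V" unfolding U_def using A by (simp add: bij_def surj_image_vimage_eq)
    have "vec.subspace U"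
      unfolding U_def using V vec.linear_subspace_vimage[OF matrix_vector_mul_linear_gen, of V A]
      by (simp add: X_flag_def Gr_def)
    then have "U \<in> X_flag k lam G"
      using V dim_bij_image[OF A] G unfolding AU[symmetric] by (simp add: X_flag_def Gr_def inter)
    then show "V \<in> translate A (X_flag k lam G)" using AU by (auto simp: translate_def)
  }
qed

lemma eta_tilde_partition:
  assumes \<eta>: "\<eta> \<in> partitions_in k n" and d: "1 \<le> d"
  shows "eta_tilde n k d \<eta> \<in> partitions_in k n"
proof -
  have "eta_tilde n k d \<eta> (j + 1) \<le> eta_tilde n k d \<eta> j" if "j \<in> {1..<k}" for j
  proof (cases "int j - int d + 1 \<le> 0")
    case True
    then show ?thesis by (simp add: eta_tilde_def eta_ext_def)
  next
    case False
    then have "nat (int j - int d + 1) = j + 1 - d" "nat (int (j + 1) - int d + 1) = j + 1 - d + 1"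
        "1 \<le> j + 1 - d" "j + 1 - d < k"
      using that d by auto
    moreover have "\<eta> (j + 1 - d + 1) \<le> \<eta> (j + 1 - d)"
      using \<eta> calculation(3,4) by (auto simp: partitions_in_def)
    ultimately show ?thesis
      using False by (simp add: eta_tilde_def eta_ext_def min.coboundedI1)
  qed
  then show ?thesis by (simp add: partitions_in_def eta_tilde_def)
qed

text \<open>
Condition \<open>j\<close> on the left corresponds to condition \<open>s = j + d - 1\<close> on the right, because
\<open>j + (\<eta>(k - s + 1) + d) = s + \<eta>(k - s + 1) + 1\<close>. If the minimum in the definition of \<open>eta_tilde\<close> is
\<open>n - k\<close>, which includes the indices with \<open>s > k\<close>, the conditions are trivial: every \<open>V\<close> meets a
space of dimension \<open>j + (n - k)\<close> in dimension at least \<open>j\<close>. The conditions on the right with \<open>s < d\<close>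
are trivial as well.
\<close>

lemma X_flag_F_tilde:
  fixes k n d :: nat and \<eta> :: "nat \<Rightarrow> nat"
  assumes n: "n = CARD('n::{finite,linorder})" and k: "1 \<le> k" "k < n" and \<eta>: "\<eta> \<in> partitions_in k n"
    and d: "1 \<le> d"
  shows "X_flag k (eta_tilde n k d \<eta>) F_tilde =
      {V \<in> Gr k :: (complex ^ ('n::{finite,linorder})) set set.
        \<forall>s\<in>{1..k}. s + 1 \<le> vec.dim (V \<inter> (F_opp (s + \<eta> (k - s + 1)) + F_std 1)) + d}"
proof (unfold X_flag_def, intro Collect_cong conj_cong refl)
  fix V :: "(complex ^ ('n::{finite,linorder})) set" assume V: "V \<in> Gr k"
  have Q: "F_opp (s + \<eta> (k - s + 1)) + F_std 1 = (F_tilde (s + \<eta> (k - s + 1) + 1) :: (complex, 'n) vec set)"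
    if "s \<in> {1..k}" for s
  proof -
    have "\<eta> (k - s + 1) \<le> n - k" using \<eta> that by (auto simp: partitions_in_def)
    then show ?thesis using that k n by (intro F_tilde_Suc[symmetric]) auto
  qed
  have triv: "j \<le> vec.dim (V \<inter> F_tilde a)" if "j \<le> k" "j + (n - k) \<le> a" for j a
  proof -
    have "k + (j + (n - k)) \<le> vec.dim (V \<inter> F_tilde (j + (n - k))) + n"
      using dim_Int_lower[of V "F_tilde (j + (n - k))" UNIV] V that k
        dim_F_tilde[of "j + (n - k)", where 'n = 'n] n
      by (simp add: Gr_def vec_dim_card del: vec.dim_UNIV)
    moreover have "vec.dim (V \<inter> F_tilde (j + (n - k))) \<le> vec.dim (V \<inter> F_tilde a)"
      using F_tilde_mono[OF that(2)] by (intro vec.dim_subset) auto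
    ultimately show ?thesis using k by linarith
  qed
  have eta: "eta_tilde n k d \<eta> (k + 1 - j) = (if j + d - 1 \<le> k then min (\<eta> (k - (j + d - 1) + 1) + d) (n - k) else n - k)"
    if "j \<in> {1..k}" for j
  proof (cases "j + d - 1 \<le> k")
    case True
    then have "nat (int (k + 1 - j) - int d + 1) = k - (j + d - 1) + 1" "int (k + 1 - j) - int d + 1 > 0"
      using that d by auto
    then show ?thesis using True by (simp add: eta_tilde_def eta_ext_def)
  next
    case False
    then have "int (k + 1 - j) - int d + 1 \<le> 0" using that d by auto
    then show ?thesis using False by (simp add: eta_tilde_def eta_ext_def)
  qed
  show "(\<forall>j\<in>{1..k}. j \<le> vec.dim (V \<inter> F_tilde (j + eta_tilde n k d \<eta> (k + 1 - j)))) \<longleftrightarrow>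
    (\<forall>s\<in>{1..k}. s + 1 \<le> vec.dim (V \<inter> (F_opp (s + \<eta> (k - s + 1)) + F_std 1)) + d)" (is "?L \<longleftrightarrow> ?R'")
  proof -
    let ?R = "\<forall>s\<in>{1..k}. s + 1 \<le> vec.dim (V \<inter> F_tilde (s + \<eta> (k - s + 1) + 1)) + d"
    have "?L \<longleftrightarrow> ?R"
    proof
      assume L: ?L
      show ?R
      proof
        fix s assume s: "s \<in> {1..k}"
        show "s + 1 \<le> vec.dim (V \<inter> F_tilde (s + \<eta> (k - s + 1) + 1)) + d"
        proof (cases "d \<le> s")
          case True
          define j where "j = s + 1 - d"
          have j: "j \<in> {1..k}" "j + d - 1 = s" "s = j + d - 1" using s True d by (auto simp: j_def)
          show ?thesis
          proof (cases "\<eta> (k - s + 1) + d \<le> n - k")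
            case True
            then have "j + eta_tilde n k d \<eta> (k + 1 - j) = s + \<eta> (k - s + 1) + 1"
              using eta[OF j(1)] s j(2) \<open>d \<le> s\<close> by (simp add: j_def)
            then show ?thesis using bspec[OF L j(1)] \<open>d \<le> s\<close> by (simp add: j_def)
          next
            case False
            then have "j \<le> vec.dim (V \<inter> F_tilde (s + \<eta> (k - s + 1) + 1))"
              using j d by (intro triv) auto
            then show ?thesis using True by (simp add: j_def)
          qed
        qed (use s in auto)
      qed
    next
      assume R: ?R
      show ?L
      proof
        fix j assume j: "j \<in> {1..k}"
        show "j \<le> vec.dim (V \<inter> F_tilde (j + eta_tilde n k d \<eta> (k + 1 - j)))"
        proof (cases "j + d - 1 \<le> k \<and> \<eta> (k - (j + d - 1) + 1) + d \<le> n - k")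
          case True
          then have "j + eta_tilde n k d \<eta> (k + 1 - j) = (j + d - 1) + \<eta> (k - (j + d - 1) + 1) + 1"
            using eta[OF j] d by simp
          moreover have "j + d - 1 \<in> {1..k}" using True j d by auto
          ultimately show ?thesis using bspec[OF R, of "j + d - 1"] d by (simp add: add.assoc)
        next
          case False
          then have "eta_tilde n k d \<eta> (k + 1 - j) = n - k" using eta[OF j] by auto
          then show ?thesis using triv[of j] j by simp
        qed
      qed
    qed
    also have "?R \<longleftrightarrow> ?R'" by (rule ball_cong[OF refl]) (simp only: Q)
    finally show ?thesis .
  qed
qed

theorem proposition4p5:
  fixes k n d i :: nat and \<eta> :: "nat \<Rightarrow> nat"
  assumes "n = CARD('n::{finite,linorder})"
    and "1 \<le> k" and "k < n"
    and "\<eta> \<in> partitions_in k n"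
    and "1 \<le> i" and "i \<le> n - k"
    and "1 \<le> d" and "d < min (k + 1) (n - k)"
  shows "Gamma_curves k d (X_special k i) (X_low k \<eta>) =
      {V \<in> Gr k :: (complex ^ ('n::{finite,linorder})) set set.
        (\<forall>j\<in>{d + 1..k}. vec.dim (V \<inter> F_opp (j + \<eta> (k - j + 1))) \<ge> j - d) \<and>
        (\<forall>s\<in>{d..k}. vec.dim (V \<inter> (F_opp (s + \<eta> (k - s + 1)) + F_std (n - k + 1 - i))) \<ge> s - d + 1)}
    \<and> eta_tilde n k d \<eta> \<in> partitions_in k n
    \<and> complete_flag (F_tilde :: nat \<Rightarrow> (complex ^ ('n::{finite,linorder})) set)
    \<and> Gamma_curves k d (X_special k (n - k)) (X_low k \<eta>)
        = X_flag k (eta_tilde n k d \<eta>) (F_tilde :: nat \<Rightarrow> (complex ^ ('n::{finite,linorder})) set)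
    \<and> X_flag k (eta_tilde n k d \<eta>) (F_tilde :: nat \<Rightarrow> (complex ^ ('n::{finite,linorder})) set)
        = translate cyc (X_low k (eta_tilde n k d \<eta>))"
proof (intro conjI)
  note n = assms(1) and k = assms(2,3) and \<eta> = assms(4) and d = assms(7)
  have j_shift: "(\<forall>j\<in>{1..k}. j \<le> a j + d) \<longleftrightarrow> (\<forall>j\<in>{d + 1..k}. a j \<ge> j - d)" for a :: "nat \<Rightarrow> nat"
    by (auto simp: le_diff_conv)
  have s_shift: "(\<forall>s\<in>{1..k}. s + 1 \<le> a s + d) \<longleftrightarrow> (\<forall>s\<in>{d..k}. a s \<ge> s - d + 1)" for a :: "nat \<Rightarrow> nat"
  proof -
    have "(s + 1 \<le> a s + d) \<longleftrightarrow> (d \<le> s \<longrightarrow> s - d + 1 \<le> a s)" for s by arith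
    then show ?thesis using d by auto
  qed
  show "Gamma_curves k d (X_special k i) (X_low k \<eta>) =
      {V \<in> Gr k :: (complex ^ ('n::{finite,linorder})) set set.
        (\<forall>j\<in>{d + 1..k}. vec.dim (V \<inter> F_opp (j + \<eta> (k - j + 1))) \<ge> j - d) \<and>
        (\<forall>s\<in>{d..k}. vec.dim (V \<inter> (F_opp (s + \<eta> (k - s + 1)) + F_std (n - k + 1 - i))) \<ge> s - d + 1)}"
    unfolding Gamma_curves_special[OF n k \<eta> assms(5,6) d] j_shift s_shift ..
  show \<eta>': "eta_tilde n k d \<eta> \<in> partitions_in k n" by (rule eta_tilde_partition[OF \<eta> d])
  show "complete_flag (F_tilde :: nat \<Rightarrow> (complex ^ ('n::{finite,linorder})) set)"
    by (rule complete_flag_F_tilde)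
  have "n - k + 1 - (n - k) = 1" "1 \<le> n - k" using k by auto
  show "Gamma_curves k d (X_special k (n - k)) (X_low k \<eta>)
        = X_flag k (eta_tilde n k d \<eta>) (F_tilde :: nat \<Rightarrow> (complex ^ ('n::{finite,linorder})) set)"
    unfolding Gamma_curves_special[OF n k \<eta> \<open>1 \<le> n - k\<close> order.refl d] X_flag_F_tilde[OF n k \<eta> d]
      \<open>n - k + 1 - (n - k) = 1\<close>
  proof (intro Collect_cong conj_cong refl iffI)
    fix V :: "(complex ^ ('n::{finite,linorder})) set" assume V: "V \<in> Gr k"
    assume Q: "\<forall>s\<in>{1..k}. s + 1 \<le> vec.dim (V \<inter> (F_opp (s + \<eta> (k - s + 1)) + F_std 1)) + d"
    \<comment> \<open>Each bound on \<open>V \<inter> (P\<^sub>s + F)\<close> implies that on \<open>V \<inter> P\<^sub>s\<close>, since \<open>F\<close> is a line.\<close>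
    have "vec.dim (V \<inter> (F_opp m + F_std 1)) \<le> vec.dim (V \<inter> F_opp m) + 1" for m
    proof -
      let ?P = "F_opp m :: (complex, 'n) vec set" and ?F = "F_std 1 :: (complex, 'n) vec set"
      have "vec.subspace V" using V by (simp add: Gr_def)
      then have "vec.dim (V \<inter> (?P + ?F)) + vec.dim ?P \<le> vec.dim (V \<inter> (?P + ?F) \<inter> ?P) + vec.dim (?P + ?F)"
        using subspace_le_plus[of ?P ?F]
        by (intro dim_Int_lower) (auto simp: vec.subspace_inter subspace_set_plus)
      moreover have "V \<inter> (?P + ?F) \<inter> ?P = V \<inter> ?P" using subspace_le_plus[of ?P ?F] by auto
      moreover have "vec.dim (?P + ?F) \<le> vec.dim ?P + 1"
        using dim_plus_Int[of ?P ?F] dim_F_std[of 1, where 'n = 'n] by (simp add: Suc_le_eq)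
      ultimately show ?thesis by simp
    qed
    note drop = this
    have "j \<le> vec.dim (V \<inter> F_opp (j + \<eta> (k - j + 1))) + d" if "j \<in> {1..k}" for j
      using bspec[OF Q that] drop[of "j + \<eta> (k - j + 1)"] by linarith
    then show "(\<forall>j\<in>{1..k}. j \<le> vec.dim (V \<inter> F_opp (j + \<eta> (k - j + 1))) + d) \<and>
        (\<forall>j\<in>{1..k}. j + 1 \<le> vec.dim (V \<inter> (F_opp (j + \<eta> (k - j + 1)) + F_std 1)) + d)"
      using Q by blast
  qed auto
  show "X_flag k (eta_tilde n k d \<eta>) (F_tilde :: nat \<Rightarrow> (complex ^ ('n::{finite,linorder})) set)
        = translate cyc (X_low k (eta_tilde n k d \<eta>))"
    unfolding X_low_def
  proof (rule X_flag_translate[OF bij_cyc])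
    fix j assume "j \<in> {1..k}"
    then have "j + eta_tilde n k d \<eta> (k + 1 - j) \<le> CARD('n)"
      using \<eta>' k n by (auto simp: partitions_in_def eta_tilde_def)
    then show "F_tilde (j + eta_tilde n k d \<eta> (k + 1 - j))
        = (*v) cyc ` (F_opp (j + eta_tilde n k d \<eta> (k + 1 - j)) :: (complex ^ ('n::{finite,linorder})) set)"
      by (rule cyc_F_opp[symmetric])
  qed
qed

end
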